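(* Let $m_1,m_2,m_3,m_4\in\mathbb{N}$ and $\epsilon\in\{0,1\}$, let $n_i=8m_i+4\epsilon+2$ for $i=1,2,3,4$, $n=n_1+n_2+n_3+n_4$, and let $L\subset\mathbb{R}^n$ be the lattice defined in the context. Then $L$ is a positive definite even unimodular lattice with theta series \begin{align*} \Theta_L(z)=&\tfrac12h_{m_1+m_2+m_3+m_4+2\epsilon+1}(z)-32\Delta_{24}(z)\big(\rho_{m_1+m_2+\epsilon-1}(z)\rho_{m_3+m_4+\epsilon-1}(z)\\ &+\rho_{m_1+m_3+\epsilon-1}(z)\rho_{m_2+m_4+\epsilon-1}(z)+\rho_{m_1+m_4+\epsilon-1}(z)\rho_{m_2+m_3+\epsilon-1}(z)\big), \end{align*} where $\rho_{-1}:=0$.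
   Context: Functions: for $\mathrm{Im}(z)>0$, $q=e^{\pi\sqrt{-1}z}$, $\vartheta_2(z)=\sum_{m\in\mathbb{Z}}q^{(m+1/2)^2}$, $\vartheta_3(z)=\sum_{m\in\mathbb{Z}}q^{m^2}$, $\vartheta_4(z)=\sum_{m\in\mathbb{Z}}(-q)^{m^2}$; $\Delta_{24}(z)=\left(\frac{\vartheta_2\vartheta_3\vartheta_4}{2}\right)^8$; for $n\in\mathbb{N}$, $h_n=\vartheta_2^{8n}+\vartheta_3^{8n}+\vartheta_4^{8n}$ and $\rho_n=\dfrac{\vartheta_3^{8(n+1)+4}-\vartheta_2^{8(n+1)+4}-\vartheta_4^{8(n+1)+4}}{(\vartheta_2\vartheta_3\vartheta_4)^4}$; by convention $\rho_{-1}=0$. Lattice: equip $\mathbb{R}^n$ with the standard inner product $\langle\cdot,\cdot\rangle$. A lattice $L\subset\mathbb{R}^n$ is even if $\langle\alpha,\alpha\rangle\in2\mathbb{Z}$ for $\alpha\in L$ and unimodular if $L=\{\alpha\in\mathbb{R}^n:\langle\alpha,\beta\rangle\in\mathbb{Z}\ \forall\beta\in L\}$; its theta series is $\Theta_L(z)=\sum_{\alpha\in L}q^{\langle\alpha,\alpha\rangle}$. Set $\bar n_0=0$, $\bar n_i=n_1+\cdots+n_i$, and $Q=\{(\alpha_1,\dots,\alpha_n)\in\mathbb{Z}^n:\sum_{j=1}^{n_i}\alpha_{\bar n_{i-1}+j}\in2\mathbb{Z}\text{ for } i=1,\dots,4\}$. With $\mathbf 0_j,\mathbf 1_j\in\mathbb{R}^j$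 the all-zero and all-one vectors, let $x^i_1=\frac12(\mathbf 0_{\bar n_{i-1}},\mathbf 1_{n_i},\mathbf 0_{n-\bar n_i})$, $x^i_2=(\mathbf 0_{\bar n_{i-1}},1,\mathbf 0_{n-\bar n_{i-1}-1})$, $x^i_3=x^i_1+x^i_2$. Define $$L=\mathbb{Z}(x^1_2+x^3_3+x^4_3)+\mathbb{Z}(x^2_2+x^4_3+x^1_3)+\mathbb{Z}(x^3_2+x^1_3+x^2_3)+\mathbb{Z}(x^4_2+x^2_3+x^3_3)+Q.$$ *)

theory Defs
  imports "HOL-Analysis.Analysis"
begin

definition qpow :: "complex \<Rightarrow> real \<Rightarrow> complex" where
  "qpow z r = exp (complex_of_real pi * \<i> * z * complex_of_real r)"

definition theta2 :: "complex \<Rightarrow> complex" where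
  "theta2 z = (\<Sum>\<^sub>\<infinity>m\<in>(UNIV::int set). qpow z ((real_of_int m + 1/2)^2))"

definition theta3 :: "complex \<Rightarrow> complex" where
  "theta3 z = (\<Sum>\<^sub>\<infinity>m\<in>(UNIV::int set). qpow z (real_of_int (m^2)))"

text \<open>(-q)^(m^2) = (-1)^(m^2) q^(m^2).\<close>
definition theta4 :: "complex \<Rightarrow> complex" where
  "theta4 z = (\<Sum>\<^sub>\<infinity>m\<in>(UNIV::int set). (-1) ^ nat (m^2) * qpow z (real_of_int (m^2)))"

definition Delta24 :: "complex \<Rightarrow> complex" where
  "Delta24 z = ((theta2 z * theta3 z * theta4 z) / 2) ^ 8"

definition hfun :: "nat \<Rightarrow> complex \<Rightarrow> complex" where
  "hfun k z = theta2 z ^ (8*k) + theta3 z ^ (8*k) + theta4 z ^ (8*k)"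

definition rho :: "int \<Rightarrow> complex \<Rightarrow> complex" where
  "rho k z = (if k < 0 then 0 else
     (let e = 8 * (nat k + 1) + 4 in
      (theta3 z ^ e - theta2 z ^ e - theta4 z ^ e) / (theta2 z * theta3 z * theta4 z) ^ 4))"

definition Rn :: "nat \<Rightarrow> (nat \<Rightarrow> real) set" where
  "Rn n = {x. \<forall>i\<ge>n. x i = 0}"

definition ip :: "nat \<Rightarrow> (nat \<Rightarrow> real) \<Rightarrow> (nat \<Rightarrow> real) \<Rightarrow> real" where
  "ip n x y = (\<Sum>i<n. x i * y i)"

definition is_lattice :: "nat \<Rightarrow> (nat \<Rightarrow> real) set \<Rightarrow> bool" where
  "is_lattice n L \<longleftrightarrow>
     L \<subseteq> Rn n \<and> (\<lambda>_. 0) \<in> L \<and>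
     (\<forall>x\<in>L. \<forall>y\<in>L. (\<lambda>i. x i + y i) \<in> L \<and> (\<lambda>i. - x i) \<in> L) \<and>
     (\<exists>e>0. \<forall>x\<in>L. x \<noteq> (\<lambda>_. 0) \<longrightarrow> e \<le> ip n x x) \<and>
     (\<exists>b::nat \<Rightarrow> nat \<Rightarrow> real. (\<forall>i<n. b i \<in> L) \<and>
        (\<forall>x\<in>Rn n. \<exists>c::nat \<Rightarrow> real. x = (\<lambda>j. \<Sum>i<n. c i * b i j)))"

definition pos_def_lattice :: "nat \<Rightarrow> (nat \<Rightarrow> real) set \<Rightarrow> bool" where
  "pos_def_lattice n L \<longleftrightarrow> is_lattice n L \<and> (\<forall>x\<in>L. x \<noteq> (\<lambda>_. 0) \<longrightarrow> ip n x x > 0)"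

definition even_lattice :: "nat \<Rightarrow> (nat \<Rightarrow> real) set \<Rightarrow> bool" where
  "even_lattice n L \<longleftrightarrow> (\<forall>a\<in>L. \<exists>k::int. ip n a a = 2 * of_int k)"

definition unimodular :: "nat \<Rightarrow> (nat \<Rightarrow> real) set \<Rightarrow> bool" where
  "unimodular n L \<longleftrightarrow> L = {a \<in> Rn n. \<forall>b\<in>L. ip n a b \<in> \<int>}"

definition theta_series_has :: "nat \<Rightarrow> (nat \<Rightarrow> real) set \<Rightarrow> complex \<Rightarrow> complex \<Rightarrow> bool" where
  "theta_series_has n L z v \<longleftrightarrow> ((\<lambda>a. qpow z (ip n a a)) has_sum v) L"

section \<open>The lattice L of the paper (blocks indexed 0..3 instead of 1..4)\<close>

definition blk :: "nat \<Rightarrow> nat \<Rightarrow> nat \<Rightarrow> nat \<Rightarrow> nat \<Rightarrow> nat" where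
  "blk n1 n2 n3 n4 i = (case i of 0 \<Rightarrow> n1 | Suc 0 \<Rightarrow> n2 | Suc (Suc 0) \<Rightarrow> n3 | _ \<Rightarrow> n4)"

definition nbar :: "nat \<Rightarrow> nat \<Rightarrow> nat \<Rightarrow> nat \<Rightarrow> nat \<Rightarrow> nat" where
  "nbar n1 n2 n3 n4 i = (\<Sum>j<i. blk n1 n2 n3 n4 j)"

definition xv1 :: "nat \<Rightarrow> nat \<Rightarrow> nat \<Rightarrow> nat \<Rightarrow> nat \<Rightarrow> nat \<Rightarrow> real" where
  "xv1 n1 n2 n3 n4 i = (\<lambda>j. if nbar n1 n2 n3 n4 i \<le> j \<and> j < nbar n1 n2 n3 n4 i + blk n1 n2 n3 n4 i
                            then 1/2 else 0)"

definition xv2 :: "nat \<Rightarrow> nat \<Rightarrow> nat \<Rightarrow> nat \<Rightarrow> nat \<Rightarrow> nat \<Rightarrow> real" where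
  "xv2 n1 n2 n3 n4 i = (\<lambda>j. if j = nbar n1 n2 n3 n4 i then 1 else 0)"

definition xv3 :: "nat \<Rightarrow> nat \<Rightarrow> nat \<Rightarrow> nat \<Rightarrow> nat \<Rightarrow> nat \<Rightarrow> real" where
  "xv3 n1 n2 n3 n4 i = (\<lambda>j. xv1 n1 n2 n3 n4 i j + xv2 n1 n2 n3 n4 i j)"

definition Qset :: "nat \<Rightarrow> nat \<Rightarrow> nat \<Rightarrow> nat \<Rightarrow> (nat \<Rightarrow> real) set" where
  "Qset n1 n2 n3 n4 = {a. (\<forall>j. a j \<in> \<int>) \<and> a \<in> Rn (n1+n2+n3+n4) \<and>
     (\<forall>i<4. \<exists>k::int. (\<Sum>j<blk n1 n2 n3 n4 i. a (nbar n1 n2 n3 n4 i + j)) = 2 * of_int k)}"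

definition genv :: "nat \<Rightarrow> nat \<Rightarrow> nat \<Rightarrow> nat \<Rightarrow> nat \<Rightarrow> nat \<Rightarrow> real" where
  "genv n1 n2 n3 n4 i = (\<lambda>j. xv2 n1 n2 n3 n4 i j + xv3 n1 n2 n3 n4 ((i+2) mod 4) j
                             + xv3 n1 n2 n3 n4 ((i+3) mod 4) j)"

definition Lat :: "nat \<Rightarrow> nat \<Rightarrow> nat \<Rightarrow> nat \<Rightarrow> (nat \<Rightarrow> real) set" where
  "Lat n1 n2 n3 n4 = {(\<lambda>j. (\<Sum>i<4. of_int (c i) * genv n1 n2 n3 n4 i j) + y j) | c y.
                        y \<in> Qset n1 n2 n3 n4}"

end

theory Submission
  imports Defs
begin

text \<open>Modulo \<open>D\<^sub>k\<close> on each of the four blocks, the lattice is a code of 16 words; a word is a choice of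
  types \<open>(s, p)\<close>, where \<open>s\<close> distinguishes integral from half-integral coordinates and \<open>p\<close> is the
  parity of the coordinate sum. Evenness is a parity count over the code, and together with closure
  under addition it gives integrality. Conversely, pairing a vector of the dual lattice with \<open>Q\<close>
  forces it to have a type on each block, and pairing it with the generators puts its types into the
  code, which is self-dual.

  The theta series of a coset of \<open>D\<^sub>k\<close> is \<open>(\<theta>\<^sub>3\<^sup>k \<plusminus> \<theta>\<^sub>4\<^sup>k) / 2\<close> or \<open>\<theta>\<^sub>2\<^sup>k / 2\<close>, so that of the lattice is
  a sum of 16 products of these, which equals the stated polynomial in the products
  \<open>\<rho>\<^sub>k (\<theta>\<^sub>2 \<theta>\<^sub>3 \<theta>\<^sub>4)\<^sup>4\<close>. Here the theta functions must not vanish (otherwise the division in \<open>\<rho>\<close>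
  would return junk), and \<open>\<rho>\<^sub>-\<^sub>1 = 0\<close> needs Jacobi's identity \<open>\<theta>\<^sub>3\<^sup>4 = \<theta>\<^sub>2\<^sup>4 + \<theta>\<^sub>4\<^sup>4\<close>. Both follow from the
  duplication formulas relating the theta functions at \<open>z\<close> and \<open>2z\<close>.\<close>

section \<open>Jacobi theta functions\<close>

text \<open>For complex series unconditional and absolute summability coincide, so summability over
  the product set follows from that of the norms. This turns products of theta functions into sums
  over pairs of integers.\<close>

lemma has_sum_product_complex:
  fixes f :: "'a \<Rightarrow> complex" and g :: "'b \<Rightarrow> complex"
  assumes f: "(f has_sum a) A" and g: "(g has_sum b) B"
  shows "((\<lambda>(x, y). f x * g y) has_sum (a * b)) (A \<times> B)"
proof (rule has_sum_SigmaI)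
  show "((\<lambda>y. case (x, y) of (x, y) \<Rightarrow> f x * g y) has_sum f x * b) B" for x
    using has_sum_cmult_right[OF g] by simp
  show "((\<lambda>x. f x * b) has_sum a * b) A"
    by (rule has_sum_cmult_left[OF f])
  have fa: "(\<lambda>x. norm (f x)) summable_on A" and ga: "(\<lambda>x. norm (g x)) summable_on B"
    using f g summable_on_iff_abs_summable_on_complex has_sum_imp_summable by blast+
  have "(\<lambda>p. norm (case p of (x, y) \<Rightarrow> f x * g y)) summable_on A \<times> B"
    unfolding Infinite_Sum.abs_summable_on_Sigma_iff
    using fa ga by (auto simp: norm_mult infsum_cmult_right' abs_mult
        intro!: summable_on_cmult_right summable_on_cmult_left)
  then show "(\<lambda>(x, y). f x * g y) summable_on A \<times> B"
    by (rule Infinite_Sum.abs_summable_summable)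
qed

lemma summable_on_power_abs_int:
  fixes t :: real
  assumes "0 \<le> t" "t < 1"
  shows "(\<lambda>m::int. t ^ nat \<bar>m\<bar>) summable_on UNIV"
proof -
  have nat: "(\<lambda>n. t ^ n) summable_on (UNIV :: nat set)"
    using assms by (intro norm_summable_imp_summable_on) (simp add: summable_geometric)
  have "(\<lambda>m::int. t ^ nat \<bar>m\<bar>) summable_on range int"
    using nat by (subst summable_on_reindex) (auto simp: o_def)
  moreover have "(\<lambda>m::int. t ^ nat \<bar>m\<bar>) summable_on range (\<lambda>n. - int n)"
    using nat by (subst summable_on_reindex) (auto simp: o_def inj_on_def)
  ultimately have "(\<lambda>m::int. t ^ nat \<bar>m\<bar>) summable_on range int \<union> range (\<lambda>n. - int n)"
    by (rule summable_on_union)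
  also have "range int \<union> range (\<lambda>n. - int n) = UNIV"
    by (auto simp: image_iff) (metis int_cases2)
  finally show ?thesis .
qed

lemma norm_qpow: "norm (qpow z r) = exp (- pi * Im z * r)"
  by (simp add: qpow_def norm_exp_eq_Re mult.commute mult.left_commute)

lemma qpow_add: "qpow z (r + s) = qpow z r * qpow z s"
  by (simp add: qpow_def algebra_simps exp_add)

lemma qpow_nonzero [simp]: "qpow z r \<noteq> 0"
  by (simp add: qpow_def)

lemma qpow_0 [simp]: "qpow z 0 = 1"
  by (simp add: qpow_def)

lemma qpow_scale: "qpow (of_nat k * z) r = qpow z (k * r)"
  by (simp add: qpow_def mult_ac)

lemma qpow_double: "qpow (2 * z) r = qpow z (2 * r)"
  by (simp add: qpow_def mult_ac)

text \<open>A quadratic exponent dominates a linear one, so the terms are bounded by a constant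
  times a two-sided geometric series. The case \<open>s = 0\<close> serves \<open>theta3\<close> and
  \<open>theta4\<close>, the case \<open>s = 1\<close> serves \<open>theta2\<close>.\<close>

lemma qpow_shifted_squares_abs_summable:
  assumes "Im z > 0"
  shows "(\<lambda>m::int. norm (qpow z ((of_int m + of_int s / 2)\<^sup>2))) summable_on UNIV"
proof (rule Infinite_Sum.abs_summable_on_comparison_test')
  define c where "c = pi * Im z"
  have c: "c > 0" using assms by (simp add: c_def)
  show "(\<lambda>m::int. exp (c * (s\<^sup>2 + 1)) * exp (- c) ^ nat \<bar>m\<bar>) summable_on UNIV"
    by (intro summable_on_cmult_right summable_on_power_abs_int) (use c in auto)
  fix m :: int
  have "\<bar>m\<bar> \<le> (m + s / 2)\<^sup>2 + (real_of_int s)\<^sup>2 + 1"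
  proof -
    \<comment> \<open>The difference of the two sides of the claim, written with squares.\<close>
    have "0 \<le> (\<bar>real_of_int m\<bar> - 1)\<^sup>2 / 2 + (real_of_int m + s)\<^sup>2 / 2 + 3 * (real_of_int s)\<^sup>2 / 4 + 1 / 2"
      by (intro add_nonneg_nonneg) auto
    then show ?thesis
      by (simp add: power2_eq_square field_simps)
  qed
  then have "c * \<bar>m\<bar> \<le> c * ((m + s / 2)\<^sup>2 + (real_of_int s)\<^sup>2 + 1)"
    using c by (intro mult_left_mono) auto
  then have "exp (- (c * (m + s / 2)\<^sup>2)) \<le> exp (c * (s\<^sup>2 + 1) + real (nat \<bar>m\<bar>) * (- c))"
    by (simp add: algebra_simps)
  also have "\<dots> = exp (c * (s\<^sup>2 + 1)) * exp (- c) ^ nat \<bar>m\<bar>"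
    by (simp only: exp_add exp_of_nat_mult)
  finally show "norm (qpow z ((of_int m + of_int s / 2)\<^sup>2)) \<le> exp (c * (s\<^sup>2 + 1)) * exp (- c) ^ nat \<bar>m\<bar>"
    by (simp add: norm_qpow c_def mult_ac)
qed

text \<open>The sign (-1)^m for arbitrary integers m. As m and m^2 have the same parity, it can
  replace the factor \<open>(-1) ^ nat (m^2)\<close> in \<open>theta4\<close>.\<close>

definition sg :: "int \<Rightarrow> complex" where
  "sg m = (if even m then 1 else -1)"

lemma sg_add: "sg (a + b) = sg a * sg b"
  by (auto simp: sg_def)

lemma sg_0 [simp]: "sg 0 = 1"
  by (simp add: sg_def)

lemma norm_sg [simp]: "norm (sg m) = 1"
  by (auto simp: sg_def)

context
  fixes z :: complex
  assumes z: "Im z > 0"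
begin

lemma theta2_has_sum: "((\<lambda>m::int. qpow z ((m + 1 / 2)\<^sup>2)) has_sum theta2 z) UNIV"
  unfolding theta2_def
  using Infinite_Sum.abs_summable_summable[OF qpow_shifted_squares_abs_summable[OF z, of 1]] by simp

lemma theta3_has_sum: "((\<lambda>m::int. qpow z ((of_int m)\<^sup>2)) has_sum theta3 z) UNIV"
  unfolding theta3_def
  using Infinite_Sum.abs_summable_summable[OF qpow_shifted_squares_abs_summable[OF z, of 0]] by simp

lemma theta4_has_sum: "((\<lambda>m::int. sg m * qpow z ((of_int m)\<^sup>2)) has_sum theta4 z) UNIV"
proof -
  have sg: "(-1) ^ nat (m\<^sup>2) = sg m" for m
    by (auto simp: sg_def even_nat_iff)
  have "(\<lambda>m::int. norm (sg m * qpow z ((of_int m)\<^sup>2))) summable_on UNIV"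
    using qpow_shifted_squares_abs_summable[OF z, of 0] by (simp add: norm_mult)
  then show ?thesis
    unfolding theta4_def sg using Infinite_Sum.abs_summable_summable by force
qed

end

section \<open>Pairs of integers by parity and the duplication formulas\<close>

lemma even_lattice_pairs_has_sum_iff:
  fixes f :: "int \<times> int \<Rightarrow> complex"
  shows "((\<lambda>(m, n). f (m + n, m - n)) has_sum S) UNIV \<longleftrightarrow> (f has_sum S) {(u, v). even (u + v)}"
proof (rule has_sum_reindex_bij_witness[where i = "\<lambda>(u, v). ((u + v) div 2, (u - v) div 2)"
      and j = "\<lambda>(m, n). (m + n, m - n)"])
  fix b :: "int \<times> int" assume "b \<in> {(u, v). even (u + v)}"
  then show "(case case b of (u, v) \<Rightarrow> ((u + v) div 2, (u - v) div 2) of (m, n) \<Rightarrow> (m + n, m - n)) = b"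
    by clarsimp presburger
qed auto

text \<open>The same change of variables for half-integers: m + 1/2 and n + 1/2 have sum m + n + 1
  and difference m - n. In the inverse, \<open>div\<close> rounds away the remaining 1/2.\<close>

lemma odd_lattice_pairs_has_sum_iff:
  fixes f :: "int \<times> int \<Rightarrow> complex"
  shows "((\<lambda>(m, n). f (m + n + 1, m - n)) has_sum S) UNIV \<longleftrightarrow> (f has_sum S) {(u, v). odd (u + v)}"
proof (rule has_sum_reindex_bij_witness[where i = "\<lambda>(u, v). ((u + v) div 2, (u - v) div 2)"
      and j = "\<lambda>(m, n). (m + n + 1, m - n)"])
  fix b :: "int \<times> int" assume "b \<in> {(u, v). odd (u + v)}"
  then show "(case case b of (u, v) \<Rightarrow> ((u + v) div 2, (u - v) div 2) of (m, n) \<Rightarrow> (m + n + 1, m - n)) = b"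
    by clarsimp presburger
qed auto

lemma has_sum_even_odd_pairs:
  fixes f :: "int \<times> int \<Rightarrow> complex"
  assumes "(f has_sum a) {(u, v). even (u + v)}" "(f has_sum b) {(u, v). odd (u + v)}"
  shows "(f has_sum (a + b)) UNIV"
proof -
  have "(f has_sum (a + b)) ({(u, v). even (u + v)} \<union> {(u, v). odd (u + v)})"
    by (rule has_sum_Un_disjoint[OF assms]) auto
  moreover have "{(u, v). even (u + v)} \<union> {(u, v). odd (u + v)} = (UNIV :: (int \<times> int) set)"
    by auto
  ultimately show ?thesis by simp
qed

text \<open>The duplication formulas come from the change of variables \<open>(m, n) \<mapsto> (m + n, m - n)\<close>,
  which doubles the form \<open>m\<^sup>2 + n\<^sup>2\<close> and has the pairs of equal parity as its image.\<close>

lemma theta_duplication: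
  assumes z: "Im z > 0"
  shows theta3_sq_plus_theta4_sq: "theta3 z ^ 2 + theta4 z ^ 2 = 2 * theta3 (2 * z) ^ 2"
    and theta3_sq_minus_theta4_sq: "theta3 z ^ 2 - theta4 z ^ 2 = 2 * theta2 (2 * z) ^ 2"
    and theta3_times_theta4: "theta3 z * theta4 z = theta4 (2 * z) ^ 2"
    and theta2_sq: "theta2 z ^ 2 = 2 * theta2 (2 * z) * theta3 (2 * z)"
proof -
  have z2: "Im (2 * z) > 0" using z by simp
  let ?E = "{(u, v). even (u + v)} :: (int \<times> int) set"
  let ?O = "{(u, v). odd (u + v)} :: (int \<times> int) set"
  define F where "F = (\<lambda>(u::int, v::int). qpow z ((of_int u)\<^sup>2 + (of_int v)\<^sup>2))"
  define G where "G = (\<lambda>(u::int, v::int). qpow z ((u + 1/2)\<^sup>2 + (v + 1/2)\<^sup>2))"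
  have e: "(F has_sum theta3 (2 * z) ^ 2) ?E"
    unfolding even_lattice_pairs_has_sum_iff[symmetric]
    using has_sum_product_complex[OF theta3_has_sum[OF z2] theta3_has_sum[OF z2]]
    by (simp add: F_def power2_eq_square case_prod_unfold qpow_double flip: qpow_add)
      (simp add: algebra_simps)
  have o: "(F has_sum theta2 (2 * z) ^ 2) ?O"
    unfolding odd_lattice_pairs_has_sum_iff[symmetric]
    using has_sum_product_complex[OF theta2_has_sum[OF z2] theta2_has_sum[OF z2]]
    by (simp add: F_def power2_eq_square case_prod_unfold qpow_double flip: qpow_add)
      (simp add: algebra_simps)
  have e': "((\<lambda>(u, v). sg u * F (u, v)) has_sum theta4 (2 * z) ^ 2) ?E"
    unfolding even_lattice_pairs_has_sum_iff[symmetric]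
    using has_sum_product_complex[OF theta4_has_sum[OF z2] theta4_has_sum[OF z2]]
    by (simp add: F_def power2_eq_square case_prod_unfold qpow_double sg_add mult.left_commute flip: qpow_add)
      (simp add: algebra_simps qpow_add)
  have "(F has_sum (theta3 (2 * z) ^ 2 + theta2 (2 * z) ^ 2)) UNIV"
    by (rule has_sum_even_odd_pairs[OF e o])
  moreover have "(F has_sum theta3 z ^ 2) UNIV"
    using has_sum_product_complex[OF theta3_has_sum[OF z] theta3_has_sum[OF z]]
    by (simp add: F_def power2_eq_square case_prod_unfold qpow_add)
  ultimately have 1: "theta3 (2 * z) ^ 2 + theta2 (2 * z) ^ 2 = theta3 z ^ 2"
    by (rule has_sum_unique)
  \<comment> \<open>The sign is constant on each parity class, so \<open>theta4 z ^ 2\<close> splits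
    into the same two sums as \<open>theta3 z ^ 2\<close>, the odd one with a minus sign.\<close>
  have "((\<lambda>(u, v). sg (u + v) * F (u, v)) has_sum theta3 (2 * z) ^ 2) ?E"
    by (rule iffD1[OF has_sum_cong e]) (auto simp: sg_def)
  moreover have "((\<lambda>(u, v). sg (u + v) * F (u, v)) has_sum - (theta2 (2 * z) ^ 2)) ?O"
    by (rule iffD1[OF has_sum_cong has_sum_uminusI[OF o]]) (auto simp: sg_def)
  ultimately have "((\<lambda>(u, v). sg (u + v) * F (u, v)) has_sum theta3 (2 * z) ^ 2 + - (theta2 (2 * z) ^ 2)) UNIV"
    by (rule has_sum_even_odd_pairs)
  moreover have "((\<lambda>(u, v). sg (u + v) * F (u, v)) has_sum theta4 z ^ 2) UNIV"
    using has_sum_product_complex[OF theta4_has_sum[OF z] theta4_has_sum[OF z]]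
    by (simp add: F_def power2_eq_square case_prod_unfold qpow_add sg_add mult_ac)
  ultimately have 2: "theta3 (2 * z) ^ 2 + - (theta2 (2 * z) ^ 2) = theta4 z ^ 2"
    by (rule has_sum_unique)
  show "theta3 z ^ 2 + theta4 z ^ 2 = 2 * theta3 (2 * z) ^ 2"
    and "theta3 z ^ 2 - theta4 z ^ 2 = 2 * theta2 (2 * z) ^ 2"
    by (simp_all flip: 1 2)

  \<comment> \<open>The odd pairs contribute 0 to the product of \<open>theta4 z\<close> and
    \<open>theta3 z\<close>: there u and v have opposite parity, so exchanging them reverses the
    sign and gives c = -c.\<close>
  obtain c where c: "((\<lambda>(u, v). sg u * F (u, v)) has_sum c) ?O"
  proof -
    have "(\<lambda>p. norm (case p of (u, v) \<Rightarrow> sg u * F (u, v))) summable_on ?O"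
      using has_sum_imp_summable[OF o] unfolding summable_on_iff_abs_summable_on_complex
      by (simp add: case_prod_unfold norm_mult)
    from that[OF has_sum_infsum[OF Infinite_Sum.abs_summable_summable[OF this]]]
    show ?thesis .
  qed
  have "((\<lambda>(u, v). - (sg u * F (u, v))) has_sum c) ?O"
    by (rule iffD1[OF has_sum_reindex_bij_witness[where i = prod.swap and j = prod.swap] c])
      (auto simp: sg_def F_def add.commute)
  from has_sum_uminusI[OF this] have "((\<lambda>(u, v). sg u * F (u, v)) has_sum - c) ?O"
    by (simp add: case_prod_unfold)
  from has_sum_unique[OF c this] have "c = - c" .
  then have "c = 0" by simp
  then have "((\<lambda>(u, v). sg u * F (u, v)) has_sum (theta4 (2 * z) ^ 2)) UNIV"
    using has_sum_even_odd_pairs[OF e' c] by simp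
  moreover have "((\<lambda>(u, v). sg u * F (u, v)) has_sum theta4 z * theta3 z) UNIV"
    using has_sum_product_complex[OF theta4_has_sum[OF z] theta3_has_sum[OF z]]
    by (simp add: F_def power2_eq_square case_prod_unfold qpow_add sg_add mult_ac)
  ultimately have "theta4 (2 * z) ^ 2 = theta4 z * theta3 z"
    by (rule has_sum_unique)
  then show "theta3 z * theta4 z = theta4 (2 * z) ^ 2"
    by (simp add: mult.commute)

  \<comment> \<open>With u = m + n and v = m - n, (u + 1/2)^2 + (v + 1/2)^2 = 2 (m + 1/2)^2 + 2
    n^2.\<close>
  have ge: "(G has_sum theta2 (2 * z) * theta3 (2 * z)) ?E"
    unfolding even_lattice_pairs_has_sum_iff[symmetric]
    using has_sum_product_complex[OF theta2_has_sum[OF z2] theta3_has_sum[OF z2]]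
    by (simp add: G_def power2_eq_square case_prod_unfold qpow_double flip: qpow_add)
      (simp add: algebra_simps)
  \<comment> \<open>The reflection v -> -1 - v preserves (v + 1/2)^2 and exchanges the two parity
    classes.\<close>
  have go: "(G has_sum theta2 (2 * z) * theta3 (2 * z)) ?O"
    by (rule iffD1[OF has_sum_reindex_bij_witness[where i = "\<lambda>(u, v). (u, - 1 - v)"
          and j = "\<lambda>(u, v). (u, - 1 - v)"] ge])
      (auto simp: G_def power2_eq_square algebra_simps)
  have "(G has_sum (2 * theta2 (2 * z) * theta3 (2 * z))) UNIV"
    using has_sum_even_odd_pairs[OF ge go] by (simp add: mult.assoc)
  note sums_eq = has_sum_unique[OF _ this]
  have "(G has_sum theta2 z ^ 2) UNIV"
    using has_sum_product_complex[OF theta2_has_sum[OF z] theta2_has_sum[OF z]]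
    by (simp add: G_def power2_eq_square case_prod_unfold qpow_add)
  then show "theta2 z ^ 2 = 2 * theta2 (2 * z) * theta3 (2 * z)"
    by (rule sums_eq)
qed

text \<open>As a difference of squares, \<open>theta3 z ^ 4 - theta4 z ^ 4\<close> has the factors
  \<open>2 * theta3 (2 * z) ^ 2\<close> and \<open>2 * theta2 (2 * z) ^ 2\<close>, whose product is
  the square of \<open>theta2 z ^ 2\<close>.\<close>

theorem Jacobi_quartic_identity:
  assumes "Im z > 0"
  shows "theta3 z ^ 4 = theta2 z ^ 4 + theta4 z ^ 4"
proof -
  have "theta3 z ^ 4 - theta4 z ^ 4 = (theta3 z ^ 2 + theta4 z ^ 2) * (theta3 z ^ 2 - theta4 z ^ 2)"
    by (simp add: ring_distribs flip: power_add)
  also have "\<dots> = (theta2 z ^ 2) ^ 2"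
    unfolding theta_duplication[OF assms] by (simp add: power_mult_distrib)
  also have "\<dots> = theta2 z ^ 4"
    by (simp flip: power_mult)
  finally show ?thesis by (simp add: algebra_simps)
qed

section \<open>Non-vanishing of the theta functions\<close>

text \<open>As k grows, all terms outside \<open>F\<close> are damped uniformly, so
  \<open>T k\<close> tends to \<open>sum s F\<close>. Here \<open>T k\<close> stands for a
  normalised theta series at 2^k z.\<close>

lemma lacunary_sum_eventually_nonzero:
  fixes s :: "int \<Rightarrow> complex" and e :: "int \<Rightarrow> real" and T :: "nat \<Rightarrow> complex"
  assumes F: "finite F" "\<And>m. m \<in> F \<Longrightarrow> e m = 0" "\<And>m. m \<notin> F \<Longrightarrow> e m \<ge> 1"
    and s: "\<And>m. norm (s m) = 1" "sum s F \<noteq> 0"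
    and z: "Im z > 0"
    and T: "\<And>k. ((\<lambda>m. s m * qpow z (2 ^ k * e m)) has_sum T k) UNIV"
  shows "\<exists>k. T k \<noteq> 0"
proof -
  define c where "c = pi * Im z"
  have c: "c > 0" using z by (simp add: c_def)
  have sm: "(\<lambda>m. exp (- c * e m)) summable_on (- F)"
  proof (rule summable_on_subset_banach)
    show "(\<lambda>m. exp (- c * e m)) summable_on UNIV"
      using has_sum_imp_summable[OF T[of 0]] unfolding summable_on_iff_abs_summable_on_complex
      by (simp add: norm_mult s norm_qpow c_def)
  qed simp
  define S where "S = infsum (\<lambda>m. exp (- c * e m)) (- F)"
  have bound: "norm (T k - sum s F) \<le> exp (c * (1 - 2 ^ k)) * S" for k
  proof (rule norm_infsum_le)
    have "((\<lambda>m. s m * qpow z (2 ^ k * e m)) has_sum (\<Sum>m\<in>F. s m * qpow z (2 ^ k * e m))) F"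
      using F(1) by (rule has_sum_finite)
    also have "(\<Sum>m\<in>F. s m * qpow z (2 ^ k * e m)) = sum s F"
      using F by (intro sum.cong) auto
    finally show "((\<lambda>m. s m * qpow z (2 ^ k * e m)) has_sum (T k - sum s F)) (- F)"
      using has_sum_Diff[OF T[of k], of F] by (simp add: Compl_eq_Diff_UNIV)
    show "((\<lambda>m. exp (c * (1 - 2 ^ k)) * exp (- c * e m)) has_sum exp (c * (1 - 2 ^ k)) * S) (- F)"
      unfolding S_def by (rule has_sum_cmult_right[OF has_sum_infsum[OF sm]])
    fix m assume "m \<in> - F"
    then have "e m \<ge> 1" using F by auto
    \<comment> \<open>Equivalently 2^k e >= (2^k - 1) + e. This splits off a factor that tends to 0
      and leaves the terms for k = 0, whose sum is \<open>S\<close>.\<close>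
    then have "0 \<le> (2 ^ k - 1) * (e m - 1)" by simp
    then have "0 \<le> c * ((2 ^ k - 1) * (e m - 1))" using c by simp
    then have "- c * (2 ^ k * e m) \<le> c * (1 - 2 ^ k) + - c * e m"
      by (simp add: algebra_simps)
    then show "norm (s m * qpow z (2 ^ k * e m)) \<le> exp (c * (1 - 2 ^ k)) * exp (- c * e m)"
      unfolding exp_add[symmetric] by (simp add: norm_mult s norm_qpow c_def)
  qed
  have "(\<lambda>k. exp c * S * exp (- c) ^ k) \<longlonglongrightarrow> exp c * S * 0"
    using c by (intro tendsto_intros LIMSEQ_realpow_zero) auto
  then have "eventually (\<lambda>k. exp c * S * exp (- c) ^ k < norm (sum s F)) sequentially"
    using s by (intro order_tendstoD) auto
  then obtain k where k: "exp c * S * exp (- c) ^ k < norm (sum s F)"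
    by (auto simp: eventually_sequentially)
  have "S \<ge> 0"
    unfolding S_def by (intro infsum_nonneg) auto
  have "real k \<le> 2 ^ k"
    by (rule less_imp_le[OF of_nat_less_two_power])
  then have "exp (c * (1 - 2 ^ k)) \<le> exp (c + real k * (- c))"
    using c by (simp add: algebra_simps)
  also have "\<dots> = exp c * exp (- c) ^ k"
    by (simp only: exp_add exp_of_nat_mult)
  finally have "exp (c * (1 - 2 ^ k)) * S \<le> exp c * exp (- c) ^ k * S"
    using \<open>S \<ge> 0\<close> by (rule mult_right_mono)
  with k have "exp (c * (1 - 2 ^ k)) * S < norm (sum s F)"
    by (simp add: mult_ac)
  with bound[of k] have "T k \<noteq> 0" by auto
  then show ?thesis ..
qed

lemma nonzero_by_doubling:
  fixes P :: "complex \<Rightarrow> bool"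
  assumes step: "\<And>w. Im w > 0 \<Longrightarrow> P (2 * w) \<Longrightarrow> P w"
    and z: "Im z > 0" and k: "P (2 ^ k * z)"
  shows "P z"
  using z k
proof (induction k arbitrary: z)
  case (Suc k)
  have "P (2 ^ k * (2 * z))"
    using Suc.prems(2) by (simp only: power_Suc mult_ac)
  moreover have "Im (2 * z) > 0"
    using Suc.prems(1) by simp
  ultimately have "P (2 * z)"
    by (intro Suc.IH[of "2 * z"])
  with Suc.prems(1) show ?case
    by (rule step)
qed simp

text \<open>Doubling the argument preserves zeros of \<open>\<theta>\<^sub>4\<close>, but far up in the half-plane \<open>\<theta>\<^sub>4\<close> is close
  to \<open>1\<close>; likewise for \<open>\<theta>\<^sub>2\<close>, which is close to \<open>2q\<^sup>1\<^sup>/\<^sup>4\<close>.\<close>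

lemma theta_nonzero:
  assumes z: "Im z > 0"
  shows theta4_nonzero: "theta4 z \<noteq> 0"
    and theta3_nonzero: "theta3 z \<noteq> 0"
    and theta2_nonzero: "theta2 z \<noteq> 0"
proof -
  have pow: "qpow (2 ^ k * w) r = qpow w (2 ^ k * r)" for k w r
    using qpow_scale[of "2 ^ k"] by simp
  have Im_pow: "Im (2 ^ k * w) = 2 ^ k * Im w" for k w
  proof -
    have "Im (of_real (2 ^ k) * w) = 2 ^ k * Im w" unfolding Im_complex_of_real by simp
    then show ?thesis by simp
  qed
  have 4: "theta4 w \<noteq> 0" if w: "Im w > 0" for w
  proof -
    have sq1: "1 \<le> (real_of_int m)\<^sup>2" if "m \<noteq> 0" for m
    proof -
      have "0 < m\<^sup>2" using that by simp
      then have "1 \<le> m\<^sup>2" by linarith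
      then show ?thesis by (metis of_int_1_le_iff of_int_power)
    qed
    have "\<exists>k. theta4 (2 ^ k * w) \<noteq> 0"
    proof (rule lacunary_sum_eventually_nonzero[where F = "{0}" and s = sg and e = "\<lambda>m. (of_int m)\<^sup>2" and z = w])
      fix k
      show "((\<lambda>m. sg m * qpow w (2 ^ k * (real_of_int m)\<^sup>2)) has_sum theta4 (2 ^ k * w)) UNIV"
        using theta4_has_sum[of "2 ^ k * w"] w by (simp add: pow Im_pow)
      show "1 \<le> (real_of_int m)\<^sup>2" if "m \<notin> {0}" for m
        using sq1 that by blast
    qed (use w in auto)
    then obtain k where k: "theta4 (2 ^ k * w) \<noteq> 0" ..
    show ?thesis
    proof (rule nonzero_by_doubling[OF _ w, of "\<lambda>w. theta4 w \<noteq> 0", OF _ k])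
      show "theta4 v \<noteq> 0" if "Im v > 0" "theta4 (2 * v) \<noteq> 0" for v
        using theta3_times_theta4[OF that(1)] that(2) by auto
    qed
  qed
  \<comment> \<open>A zero of \<open>theta3\<close> at w would make \<open>theta4\<close> vanish at
    2w.\<close>
  have 3: "theta3 w \<noteq> 0" if "Im w > 0" for w
    using theta3_times_theta4[OF that] 4[of "2 * w"] that by auto
  show "theta4 z \<noteq> 0" "theta3 z \<noteq> 0"
    using 3 4 z by auto
  \<comment> \<open>The leading exponent 1/4 of \<open>theta2\<close> is divided out. What remains
    is (m + 1/2)^2 - 1/4 = m (m + 1), which is 0 exactly for m = 0 and m = -1.\<close>
  have "\<exists>k. theta2 (2 ^ k * z) / qpow z (2 ^ k / 4) \<noteq> 0"
  proof (rule lacunary_sum_eventually_nonzero[where F = "{0, -1}" and s = "\<lambda>_. 1"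
        and e = "\<lambda>m. (m + 1 / 2)\<^sup>2 - 1 / 4" and z = z])
    fix k
    have *: "qpow z (2 ^ k * r) / qpow z (2 ^ k / 4) = qpow z (2 ^ k * (r - 1 / 4))" for r
      by (simp add: divide_simps flip: qpow_add) (simp add: algebra_simps)
    show "((\<lambda>m. 1 * qpow z (2 ^ k * ((real_of_int m + 1 / 2)\<^sup>2 - 1 / 4))) has_sum
           theta2 (2 ^ k * z) / qpow z (2 ^ k / 4)) UNIV"
      using has_sum_cmult_left[OF theta2_has_sum[of "2 ^ k * z"], of "inverse (qpow z (2 ^ k / 4))"] z
      by (simp add: pow Im_pow * flip: divide_inverse)
  next
    fix m :: int assume "m \<notin> {0, -1}"
    then have "m \<ge> 1 \<or> m + 1 \<le> -1" by auto
    then have "1 \<le> m * (m + 1)"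
    proof
      assume "m \<ge> 1"
      then have "1 * 1 \<le> m * (m + 1)" by (intro mult_mono) auto
      then show ?thesis by simp
    next
      assume "m + 1 \<le> -1"
      then have "1 * 1 \<le> (- m) * (- (m + 1))" by (intro mult_mono) auto
      then show ?thesis by (simp add: algebra_simps)
    qed
    then have "1 \<le> real_of_int (m * (m + 1))" by (metis of_int_1_le_iff)
    then show "1 \<le> (real_of_int m + 1 / 2)\<^sup>2 - 1 / 4"
      by (simp add: power2_eq_square algebra_simps)
  next
    show "(real_of_int m + 1 / 2)\<^sup>2 - 1 / 4 = 0" if "m \<in> {0, -1}" for m
      using that by (auto simp: power2_eq_square)
  qed (use z in auto)
  then obtain k where k: "theta2 (2 ^ k * z) \<noteq> 0" by auto
  show "theta2 z \<noteq> 0"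
  proof (rule nonzero_by_doubling[OF _ z, of "\<lambda>w. theta2 w \<noteq> 0", OF _ k])
    show "theta2 v \<noteq> 0" if "Im v > 0" "theta2 (2 * v) \<noteq> 0" for v
      using theta2_sq[OF that(1)] that(2) 3[of "2 * v"] that(1) by auto
  qed
qed

section \<open>Block types\<close>

text \<open>The coordinates \<open>b, \<dots>, b + k - 1\<close> form a vector in the coset of \<open>D\<^sub>k\<close> with representative \<open>s \<cdot> (1/2, \<dots>, 1/2) + p \<cdot> (1, 0, \<dots>, 0)\<close>.\<close>

definition block_type :: "nat \<Rightarrow> nat \<Rightarrow> int \<Rightarrow> int \<Rightarrow> (nat \<Rightarrow> real) \<Rightarrow> bool" where
  "block_type b k s p x \<longleftrightarrow>
     (\<forall>j<k. x (b + j) - s / 2 \<in> \<int>) \<and> (\<exists>c::int. (\<Sum>j<k. x (b + j)) - real_of_int s * real k / 2 = real_of_int (2 * c + p))"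

lemma block_type_coord:
  assumes "block_type b k s p x" "j < k"
  shows "x (b + j) - s / 2 \<in> \<int>"
  using assms by (simp add: block_type_def)

lemma block_type_sum:
  assumes "block_type b k s p x"
  obtains c :: int where "(\<Sum>j<k. x (b + j)) - real_of_int s * real k / 2 = real_of_int (2 * c + p)"
  using assms unfolding block_type_def by (elim conjE exE)

lemma block_typeE:
  assumes "block_type b k s p x"
  obtains t :: "nat \<Rightarrow> int" and c :: int
    where "\<And>j. j < k \<Longrightarrow> x (b + j) = t j + s / 2" "(\<Sum>j<k. t j) = 2 * c + p"
proof -
  define t where "t j = \<lfloor>x (b + j) - s / 2\<rfloor>" for j
  have t: "x (b + j) = t j + s / 2" if "j < k" for j
  proof -
    have "x (b + j) - s / 2 \<in> \<int>"
      using assms that by (rule block_type_coord)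
    then obtain m where "x (b + j) - s / 2 = of_int m"
      by (rule Ints_cases)
    then show ?thesis by (simp add: t_def)
  qed
  obtain c :: int where c: "(\<Sum>j<k. x (b + j)) - real_of_int s * real k / 2 = real_of_int (2 * c + p)"
    using assms by (rule block_type_sum)
  have "(\<Sum>j<k. x (b + j)) = (\<Sum>j<k. real_of_int (t j) + s / 2)"
    by (intro sum.cong t) auto
  also have "\<dots> = real_of_int (\<Sum>j<k. t j) + s * k / 2"
    by (simp add: sum.distrib)
  finally have "real_of_int (\<Sum>j<k. t j) = real_of_int (2 * c + p)"
    using c by simp
  then have "(\<Sum>j<k. t j) = 2 * c + p"
    by (simp only: of_int_eq_iff)
  from that[OF t this] show ?thesis .
qed

lemma block_type_add:
  assumes "block_type b k s p x" "block_type b k s' p' y"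
  shows "block_type b k (s + s') (p + p') (\<lambda>i. x i + y i)"
  unfolding block_type_def
proof (intro conjI allI impI)
  fix j assume "j < k"
  then have "(x (b + j) - s / 2) + (y (b + j) - s' / 2) \<in> \<int>"
    using assms by (intro Ints_add block_type_coord)
  then show "x (b + j) + y (b + j) - real_of_int (s + s') / 2 \<in> \<int>"
    by (simp add: algebra_simps add_divide_distrib)
next
  obtain c where c: "(\<Sum>j<k. x (b + j)) - real_of_int s * real k / 2 = real_of_int (2 * c + p)"
    using assms(1) by (rule block_type_sum)
  obtain c' where "(\<Sum>j<k. y (b + j)) - real_of_int s' * real k / 2 = real_of_int (2 * c' + p')"
    using assms(2) by (rule block_type_sum)
  with c have "(\<Sum>j<k. x (b + j) + y (b + j)) - real_of_int (s + s') * k / 2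
      = real_of_int (2 * (c + c') + (p + p'))"
    by (simp add: sum.distrib algebra_simps add_divide_distrib)
  then show "\<exists>c::int. (\<Sum>j<k. x (b + j) + y (b + j)) - real_of_int (s + s') * k / 2
      = real_of_int (2 * c + (p + p'))" ..
qed

lemma block_type_uminus:
  assumes "block_type b k s p x"
  shows "block_type b k (- s) (- p) (\<lambda>i. - x i)"
  unfolding block_type_def
proof (intro conjI allI impI)
  fix j assume "j < k"
  then have "- (x (b + j) - s / 2) \<in> \<int>"
    using assms by (intro Ints_minus block_type_coord)
  then show "- x (b + j) - real_of_int (- s) / 2 \<in> \<int>"
    by (simp add: algebra_simps)
next
  obtain c where "(\<Sum>j<k. x (b + j)) - real_of_int s * real k / 2 = real_of_int (2 * c + p)"
    using assms by (rule block_type_sum)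
  then have "(\<Sum>j<k. - x (b + j)) - real_of_int (- s) * k / 2
      = real_of_int (2 * (- c) + - p)"
    by (simp add: sum_negf algebra_simps)
  then show "\<exists>c::int. (\<Sum>j<k. - x (b + j)) - real_of_int (- s) * k / 2
      = real_of_int (2 * c + - p)" ..
qed

text \<open>Lowering s by 2u raises the corrected coordinate sum by u k, which is even because k is.
  Hence only the residues of s and p modulo 2 matter.\<close>

lemma block_type_mod_2:
  assumes x: "block_type b k s p x" and "even k" "even (s - s')" "even (p - p')"
  shows "block_type b k s' p' x"
proof -
  obtain u where u: "s - s' = 2 * u"
    using \<open>even (s - s')\<close> ..
  obtain v where v: "p - p' = 2 * v"
    using \<open>even (p - p')\<close> ..
  obtain l where l: "k = 2 * l"
    using assms by (auto elim!: evenE)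
  have s: "real_of_int s = s' + 2 * u" and p: "real_of_int p = p' + 2 * v"
    using u v by linarith+
  show ?thesis
    unfolding block_type_def
  proof (intro conjI allI impI)
    fix j assume "j < k"
    then have "(x (b + j) - s / 2) + u \<in> \<int>"
      using x by (intro Ints_add Ints_of_int block_type_coord)
    then show "x (b + j) - s' / 2 \<in> \<int>"
      by (simp add: s add_divide_distrib algebra_simps)
  next
    obtain c :: int where c: "(\<Sum>j<k. x (b + j)) - real_of_int s * real k / 2 = real_of_int (2 * c + p)"
      using x by (rule block_type_sum)
    have "(\<Sum>j<k. x (b + j)) - real_of_int s' * real k / 2 = real_of_int (2 * (c + v + u * int l) + p')"
      using c by (simp add: s p l algebra_simps add_divide_distrib)
    then show "\<exists>c::int. (\<Sum>j<k. x (b + j)) - real_of_int s' * real k / 2 = real_of_int (2 * c + p')" ..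
  qed
qed

text \<open>The first coordinate, which exists as k > 0, fixes s modulo 2; the coordinate sum then
  fixes p modulo 2. This makes different code words give disjoint cosets.\<close>

lemma block_type_unique:
  assumes x: "block_type b k s p x" and y: "block_type b k s' p' x" and k: "even k" "k > 0"
  shows "even (s - s')" "even (p - p')"
proof -
  have "(x (b + 0) - s' / 2) - (x (b + 0) - s / 2) \<in> \<int>"
    by (intro Ints_diff block_type_coord[OF x] block_type_coord[OF y] k)
  then obtain u :: int where "(s - s') / 2 = real_of_int u"
    by (auto elim!: Ints_cases simp: diff_divide_distrib)
  then have "real_of_int (s - s') = real_of_int (2 * u)" by simp
  then have u: "s - s' = 2 * u" by (simp only: of_int_eq_iff)
  then show "even (s - s')" by simp
  obtain l where l: "k = 2 * l"
    using k by (auto elim!: evenE)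
  obtain c where c: "(\<Sum>j<k. x (b + j)) - real_of_int s * real k / 2 = real_of_int (2 * c + p)"
    using x by (rule block_type_sum)
  obtain c' where "(\<Sum>j<k. x (b + j)) - real_of_int s' * real k / 2 = real_of_int (2 * c' + p')"
    using y by (rule block_type_sum)
  with c have "real_of_int (p - p') = real_of_int (2 * (c' - c) - (s - s') * l)"
    by (simp add: l algebra_simps)
  then have "p - p' = 2 * (c' - c) - (s - s') * l" by (simp only: of_int_eq_iff)
  then show "even (p - p')" unfolding u by simp
qed

text \<open>Write the coordinates as t + s/2 with integers t. The sum of the t^2 has the parity of
  the sum of the t, which is that of p; the cross terms add s times the sum of the t.\<close>

lemma block_type_norm:
  assumes "block_type b k s p x"
  obtains d :: int where "(\<Sum>j<k. x (b + j) * x (b + j)) = 2 * real_of_int d + real_of_int ((1 + s) * p) + real_of_int (s\<^sup>2) * real k / 4"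
proof -
  obtain t c where t: "\<And>j. j < k \<Longrightarrow> x (b + j) = t j + s / 2" and c: "(\<Sum>j<k. t j) = 2 * c + p"
    using assms by (rule block_typeE) blast
  have "even (\<Sum>j<k. t j * (t j - 1))"
    by (intro dvd_sum) auto
  then obtain w where "(\<Sum>j<k. t j * (t j - 1)) = 2 * w" ..
  then have w: "(\<Sum>j<k. t j * t j) = 2 * w + 2 * c + p"
    using c by (simp add: algebra_simps sum_subtractf)
  have "(\<Sum>j<k. x (b + j) * x (b + j)) = (\<Sum>j<k. real_of_int (t j * t j) + s * t j + s\<^sup>2 / 4)"
    by (intro sum.cong refl) (use t in \<open>simp add: power2_eq_square algebra_simps\<close>)
  also have "\<dots> = real_of_int (\<Sum>j<k. t j * t j) + s * real_of_int (\<Sum>j<k. t j) + s\<^sup>2 * k / 4"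
    by (simp add: sum.distrib sum_distrib_left)
  also have "\<dots> = 2 * real_of_int (w + c + s * c) + real_of_int ((1 + s) * p) + real_of_int (s\<^sup>2) * real k / 4"
    unfolding w c by (simp add: algebra_simps)
  finally show ?thesis by (rule that)
qed

lemma sum_lessThan_add:
  fixes f :: "nat \<Rightarrow> 'a::comm_monoid_add"
  shows "(\<Sum>j<a + b. f j) = (\<Sum>j<a. f j) + (\<Sum>j<b. f (a + j))"
  by (induction b) (auto simp: add_ac)

lemma less_4_cases:
  assumes "i < (4::nat)"
  obtains "i = 0" | "i = 1" | "i = 2" | "i = 3"
  using assms by linarith

lemma sum_lessThan_4: "(\<Sum>i<4. f i) = f 0 + f 1 + f 2 + f (3::nat)"
  by (simp add: eval_nat_numeral add_ac)

lemma prod_lessThan_4: "(\<Prod>i<4. f i) = f 0 * f (Suc 0) * f 2 * f (3::nat)"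
  by (simp add: eval_nat_numeral mult_ac)

text \<open>On block \<open>i\<close> the combination \<open>\<Sum> c\<^sub>j g\<^sub>j\<close> of the four generators of the lattice has type
  \<open>(glue_s c i, glue_p c i)\<close>: the generators \<open>g\<^sub>i\<^sub>+\<^sub>1\<close> and \<open>g\<^sub>i\<^sub>+\<^sub>2\<close> (indices mod 4) contribute a vector
  \<open>x\<^sub>3\<close> there, and \<open>g\<^sub>i\<close> contributes \<open>x\<^sub>2\<close>.\<close>

definition glue_s :: "(nat \<Rightarrow> int) \<Rightarrow> nat \<Rightarrow> int" where
  "glue_s c i = c ((i + 1) mod 4) + c ((i + 2) mod 4)"

lemma glue_s_simps:
  "glue_s c 0 = c (Suc 0) + c 2" "glue_s c (Suc 0) = c 2 + c 3"
  "glue_s c 2 = c 3 + c 0" "glue_s c 3 = c 0 + c (Suc 0)"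
  by (simp_all add: glue_s_def flip: numeral_2_eq_2)

definition glue_p :: "(nat \<Rightarrow> int) \<Rightarrow> nat \<Rightarrow> int" where
  "glue_p c i = c i + glue_s c i"

section \<open>Theta series of products of blocks\<close>

text \<open>Padded with zeros because \<open>Rn k\<close> consists of functions on all of
  \<open>nat\<close> that vanish from k on. A shifted tail needs no padding.\<close>

definition take_coords :: "nat \<Rightarrow> (nat \<Rightarrow> real) \<Rightarrow> nat \<Rightarrow> real" where
  "take_coords k x = (\<lambda>j. if j < k then x j else 0)"

lemma has_sum_append:
  fixes f g :: "(nat \<Rightarrow> real) \<Rightarrow> complex"
  assumes f: "(f has_sum a) {x \<in> Rn k. P x}" and g: "(g has_sum b) {x \<in> Rn l. R x}"
  shows "((\<lambda>x. f (take_coords k x) * g (\<lambda>j. x (k + j))) has_sum (a * b))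
    {x \<in> Rn (k + l). P (take_coords k x) \<and> R (\<lambda>j. x (k + j))}"
proof (rule iffD1[OF has_sum_reindex_bij_witness has_sum_product_complex[OF f g]])
  let ?j = "\<lambda>(u, v) j. if j < k then u j else v (j - k) :: real"
  let ?i = "\<lambda>x. (take_coords k x, \<lambda>j. x (k + j))"
  fix p :: "(nat \<Rightarrow> real) \<times> (nat \<Rightarrow> real)"
  assume p: "p \<in> {x \<in> Rn k. P x} \<times> {x \<in> Rn l. R x}"
  obtain u v where uv: "p = (u, v)" by (cases p)
  have 1: "take_coords k (?j (u, v)) = u" "(\<lambda>j. ?j (u, v) (k + j)) = v"
    using p by (auto simp: uv take_coords_def Rn_def fun_eq_iff)
  then show "?i (?j p) = p"
    by (simp add: uv)
  show "?j p \<in> {x \<in> Rn (k + l). P (take_coords k x) \<and> R (\<lambda>j. x (k + j))}"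
    using p 1 by (auto simp: uv Rn_def)
  show "f (take_coords k (?j p)) * g (\<lambda>j. ?j p (k + j)) = (case p of (x, y) \<Rightarrow> f x * g y)"
    using 1 by (simp add: uv)
next
  let ?j = "\<lambda>(u, v) j. if j < k then u j else v (j - k) :: real"
  let ?i = "\<lambda>x. (take_coords k x, \<lambda>j. x (k + j))"
  fix x :: "nat \<Rightarrow> real"
  assume x: "x \<in> {x \<in> Rn (k + l). P (take_coords k x) \<and> R (\<lambda>j. x (k + j))}"
  show "?j (?i x) = x"
    by (auto simp: take_coords_def fun_eq_iff)
  show "?i x \<in> {x \<in> Rn k. P x} \<times> {x \<in> Rn l. R x}"
    using x by (auto simp: Rn_def take_coords_def)
qed simp

lemma has_sum_coordinates:
  fixes f :: "real \<Rightarrow> complex"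
  assumes f: "(f has_sum v) S"
  shows "((\<lambda>x. \<Prod>i<k. f (x i)) has_sum v ^ k) {x \<in> Rn k. \<forall>i<k. x i \<in> S}"
proof (induction k)
  case 0
  \<comment> \<open>\<open>Rn 0\<close> contains only the zero vector, over which the empty product
    sums to 1.\<close>
  have "{x \<in> Rn 0. \<forall>i<0. x i \<in> S} = {\<lambda>_. 0}"
    by (auto simp: Rn_def)
  then show ?case
    using has_sum_finite[of "{\<lambda>_::nat. 0::real}" "\<lambda>_. 1::complex"] by simp
next
  case (Suc k)
  have 1: "((\<lambda>x. f (x 0)) has_sum v) {x \<in> Rn 1. x 0 \<in> S}"
    by (rule iffD1[OF has_sum_reindex_bij_witness[where i = "\<lambda>x. x 0"
          and j = "\<lambda>t i. if i = 0 then t else 0"] f])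
      (auto simp: Rn_def fun_eq_iff)
  have set: "{x \<in> Rn (k + 1). (\<forall>i<k. take_coords k x i \<in> S) \<and> x (k + 0) \<in> S}
      = {x \<in> Rn (Suc k). \<forall>i<Suc k. x i \<in> S}"
    by (auto simp: take_coords_def less_Suc_eq)
  have prod: "(\<Prod>i<k. f (take_coords k x i)) * f (x (k + 0)) = (\<Prod>i<Suc k. f (x i))" for x
    by (simp add: take_coords_def)
  show ?case
    using has_sum_append[OF Suc.IH 1] unfolding set prod by (simp only: power_Suc2)
qed

lemma qpow_ip: "qpow z (ip k x x) = (\<Prod>i<k. qpow z ((x i)\<^sup>2))"
  by (induction k) (simp_all add: ip_def qpow_add power2_eq_square mult.commute)

lemma sg_sum: "sg (\<Sum>i<k. t i) = (\<Prod>i<k. sg (t i))" for k :: nat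
  by (induction k) (simp_all add: sg_add)

lemma theta_append:
  assumes f: "((\<lambda>x. qpow z (ip k x x)) has_sum a) {x \<in> Rn k. P x}"
    and g: "((\<lambda>x. qpow z (ip l x x)) has_sum b) {x \<in> Rn l. R x}"
  shows "((\<lambda>x. qpow z (ip (k + l) x x)) has_sum (a * b))
    {x \<in> Rn (k + l). P (take_coords k x) \<and> R (\<lambda>j. x (k + j))}"
proof -
  have "qpow z (ip k (take_coords k x) (take_coords k x)) * qpow z (ip l (\<lambda>j. x (k + j)) (\<lambda>j. x (k + j)))
      = qpow z (ip (k + l) x x)" for x
  proof -
    have "ip (k + l) x x = ip k (take_coords k x) (take_coords k x) + ip l (\<lambda>j. x (k + j)) (\<lambda>j. x (k + j))"
      by (simp add: ip_def sum_lessThan_add take_coords_def)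
    then show ?thesis by (simp add: qpow_add)
  qed
  with has_sum_append[OF f g] show ?thesis by simp
qed

text \<open>The two coset sums of \<open>q^(t^2)\<close> and \<open>(-1)^(t - s/2) q^(t^2)\<close> over \<open>\<int> + s/2\<close> determine the theta series
  of each coset of \<open>D\<^sub>k\<close>, since the parity condition has indicator \<open>(1 \<plusminus> (-1)^(\<Sum> (t - s/2))) / 2\<close>.\<close>

lemma block_theta_aux:
  assumes v: "((\<lambda>m::int. qpow z ((m + s / 2)\<^sup>2)) has_sum v) UNIV"
    and w: "((\<lambda>m::int. sg m * qpow z ((m + s / 2)\<^sup>2)) has_sum w) UNIV"
  shows "((\<lambda>x. qpow z (ip k x x)) has_sum (v ^ k + sg p * w ^ k) / 2) {x \<in> Rn k. block_type 0 k s p x}"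
proof -
  let ?S = "{t::real. t - s / 2 \<in> \<int>}"
  \<comment> \<open>The floor recovers the integer m from the point m + s/2 of the shifted
    lattice.\<close>
  let ?h = "\<lambda>t. sg \<lfloor>t - s / 2\<rfloor> * qpow z (t\<^sup>2)"
  have reindex: "((\<lambda>m::int. f (m + s / 2)) has_sum c) UNIV \<longleftrightarrow> (f has_sum c) ?S"
    for f :: "real \<Rightarrow> complex" and c
    by (rule has_sum_reindex_bij_witness[where i = "\<lambda>t. \<lfloor>t - s / 2\<rfloor>" and j = "\<lambda>m. m + s / 2"])
      (auto elim!: Ints_cases simp: diff_eq_eq)
  have V: "((\<lambda>x. \<Prod>i<k. qpow z ((x i)\<^sup>2)) has_sum v ^ k) {x \<in> Rn k. \<forall>i<k. x i \<in> ?S}"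
    by (intro has_sum_coordinates iffD1[OF reindex] v)
  have "(?h has_sum w) ?S"
    by (rule iffD1[OF reindex]) (use w in simp)
  then have W: "((\<lambda>x. \<Prod>i<k. ?h (x i)) has_sum w ^ k) {x \<in> Rn k. \<forall>i<k. x i \<in> ?S}"
    by (rule has_sum_coordinates)
  have VW: "((\<lambda>x. ((\<Prod>i<k. qpow z ((x i)\<^sup>2)) + sg p * (\<Prod>i<k. ?h (x i))) * (1 / 2)) has_sum
      (v ^ k + sg p * w ^ k) * (1 / 2)) {x \<in> Rn k. \<forall>i<k. x i \<in> ?S}"
    by (intro has_sum_cmult_left has_sum_add V has_sum_cmult_right W)
  have key: "((\<Prod>i<k. qpow z ((x i)\<^sup>2)) + sg p * (\<Prod>i<k. ?h (x i))) * (1 / 2)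
      = (if block_type 0 k s p x then qpow z (ip k x x) else 0)" if x: "\<forall>i<k. x i \<in> ?S" for x
  proof -
    define t where "t i = \<lfloor>x i - s / 2\<rfloor>" for i
    have t: "x i = t i + s / 2" if "i < k" for i
    proof -
      have "x i - s / 2 \<in> \<int>" using x that by auto
      then obtain m where "x i - s / 2 = of_int m" by (rule Ints_cases)
      then show ?thesis by (simp add: t_def)
    qed
    have "(\<Sum>j<k. x j) = (\<Sum>j<k. real_of_int (t j) + s / 2)"
      by (intro sum.cong t) auto
    then have "(\<Sum>j<k. x j) - real_of_int s * real k / 2 = real_of_int (\<Sum>j<k. t j)"
      by (simp add: sum.distrib)
    then have "block_type 0 k s p x \<longleftrightarrow> (\<exists>c. (\<Sum>j<k. t j) = 2 * c + p)"
      using x unfolding block_type_def by (simp only: of_int_eq_iff add_0) simp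
    also have "\<dots> \<longleftrightarrow> even ((\<Sum>j<k. t j) + p)"
    proof -
      have "(\<exists>c. a = 2 * c + p) \<longleftrightarrow> even (a + p)" for a :: int
        by presburger
      then show ?thesis .
    qed
    also have "\<dots> \<longleftrightarrow> sg p * sg (\<Sum>j<k. t j) = 1"
      by (auto simp: sg_def)
    finally have iff: "block_type 0 k s p x \<longleftrightarrow> sg p * sg (\<Sum>j<k. t j) = 1" .
    have "sg p * sg (\<Sum>j<k. t j) = 1 \<or> sg p * sg (\<Sum>j<k. t j) = -1"
      by (auto simp: sg_def)
    moreover have "(\<Prod>i<k. ?h (x i)) = sg (\<Sum>j<k. t j) * qpow z (ip k x x)"
      by (simp add: prod.distrib sg_sum qpow_ip t_def)
    ultimately show ?thesis
      unfolding iff by (auto simp: qpow_ip mult.assoc[symmetric])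
  qed
  have "((\<lambda>x. qpow z (ip k x x)) has_sum (v ^ k + sg p * w ^ k) * (1 / 2)) {x \<in> Rn k. block_type 0 k s p x}"
  proof (rule iffD1[OF has_sum_cong_neutral VW])
    fix x assume "x \<in> {x \<in> Rn k. block_type 0 k s p x} - {x \<in> Rn k. \<forall>i<k. x i \<in> ?S}"
    then show "qpow z (ip k x x) = 0" by (auto simp: block_type_def)
  next
    fix x assume "x \<in> {x \<in> Rn k. \<forall>i<k. x i \<in> ?S} - {x \<in> Rn k. block_type 0 k s p x}"
    then show "((\<Prod>i<k. qpow z ((x i)\<^sup>2)) + sg p * (\<Prod>i<k. ?h (x i))) * (1 / 2) = 0"
      by (subst key) auto
  next
    fix x assume "x \<in> {x \<in> Rn k. \<forall>i<k. x i \<in> ?S} \<inter> {x \<in> Rn k. block_type 0 k s p x}"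
    then show "((\<Prod>i<k. qpow z ((x i)\<^sup>2)) + sg p * (\<Prod>i<k. ?h (x i))) * (1 / 2) = qpow z (ip k x x)"
      by (subst key) auto
  qed
  then show ?thesis by simp
qed

text \<open>For odd s the alternating series that would take the place of \<open>theta4\<close> is
  0, so the value is independent of p.\<close>

definition block_theta :: "complex \<Rightarrow> nat \<Rightarrow> int \<Rightarrow> int \<Rightarrow> complex" where
  "block_theta z k s p = (if even s then (theta3 z ^ k + sg p * theta4 z ^ k) / 2 else theta2 z ^ k / 2)"

text \<open>The reflection m -> -1 - m preserves (m + 1/2)^2 and reverses the sign, so the sum
  equals its own negative.\<close>

lemma alternating_theta2_has_sum:
  assumes z: "Im z > 0"
  shows "((\<lambda>m::int. sg m * qpow z ((m + 1 / 2)\<^sup>2)) has_sum 0) UNIV"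
proof -
  let ?f = "\<lambda>m::int. sg m * qpow z ((m + 1 / 2)\<^sup>2)"
  have "(\<lambda>m. norm (?f m)) summable_on UNIV"
    using qpow_shifted_squares_abs_summable[OF z, of 1] by (simp add: norm_mult)
  note sm = has_sum_infsum[OF Infinite_Sum.abs_summable_summable[OF this]]
  have "((\<lambda>m. - ?f m) has_sum infsum ?f UNIV) UNIV"
    by (rule iffD1[OF has_sum_reindex_bij_witness[where i = "\<lambda>m. - 1 - m" and j = "\<lambda>m. - 1 - m"] sm])
      (auto simp: sg_def power2_eq_square algebra_simps)
  from has_sum_uminusI[OF this] have "(?f has_sum - infsum ?f UNIV) UNIV" by simp
  from has_sum_unique[OF sm this] have "infsum ?f UNIV = 0" by simp
  with sm show ?thesis by simp
qed

lemma block_theta_has_sum: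
  assumes z: "Im z > 0" and k: "even k" "k > 0"
  shows "((\<lambda>x. qpow z (ip k x x)) has_sum block_theta z k s p) {x \<in> Rn k. block_type 0 k s p x}"
proof -
  have mod2: "block_type 0 k s p x \<longleftrightarrow> block_type 0 k (s mod 2) p x" for x
  proof -
    have "even (s - s mod 2)" "even (s mod 2 - s)" by presburger+
    then show ?thesis
      using block_type_mod_2[of 0 k s p x "s mod 2" p] block_type_mod_2[of 0 k "s mod 2" p x s p] k(1)
      by auto
  qed
  show ?thesis
  proof (cases "even s")
    case True
    then have "s mod 2 = 0" by presburger
    then show ?thesis
      using block_theta_aux[of z 0 "theta3 z" "theta4 z" k p] theta3_has_sum[OF z] theta4_has_sum[OF z] True
      by (simp add: mod2 block_theta_def)
  next
    case False
    then have "s mod 2 = 1" by presburger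
    then show ?thesis
      \<comment> \<open>The alternating sum enters as \<open>0 ^ k\<close>, which is 0 because k >
        0.\<close>
      using block_theta_aux[of z 1 "theta2 z" 0 k p] theta2_has_sum[OF z]
        alternating_theta2_has_sum[OF z] False k
      by (simp add: mod2 block_theta_def power_0_left)
  qed
qed

lemma block_type_take_coords: "block_type 0 k s p (take_coords k x) \<longleftrightarrow> block_type 0 k s p x"
  by (simp add: block_type_def take_coords_def)

lemma has_sum_UN_disjoint:
  fixes f :: "'a \<Rightarrow> complex"
  assumes "finite I" "\<And>i. i \<in> I \<Longrightarrow> (f has_sum v i) (T i)"
    and "\<And>i j. i \<in> I \<Longrightarrow> j \<in> I \<Longrightarrow> i \<noteq> j \<Longrightarrow> T i \<inter> T j = {}"
  shows "(f has_sum (\<Sum>i\<in>I. v i)) (\<Union>i\<in>I. T i)"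
  using assms
proof (induction I)
  case (insert i I)
  have "(f has_sum (v i + (\<Sum>i\<in>I. v i))) (T i \<union> (\<Union>i\<in>I. T i))"
  proof (rule has_sum_Un_disjoint)
    show "(f has_sum v i) (T i)"
      by (rule insert.prems(1)) simp
    show "(f has_sum (\<Sum>i\<in>I. v i)) (\<Union>i\<in>I. T i)"
      by (rule insert.IH) (use insert.prems in auto)
    show "T i \<inter> (\<Union>i\<in>I. T i) = {}"
      using insert.prems(2)[of i] insert.hyps(2) by blast
  qed
  then show ?case using insert.hyps by simp
qed simp

text \<open>Coefficients given as tuples make \<open>bits\<close> a finite index set with one
  element per code word; functions on \<open>nat\<close> would also differ at irrelevant
  indices.\<close>

definition quad :: "int \<times> int \<times> int \<times> int \<Rightarrow> nat \<Rightarrow> int" where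
  "quad = (\<lambda>(c0, c1, c2, c3) i. if i = 0 then c0 else if i = 1 then c1 else if i = 2 then c2 else c3)"

lemma quad_simps [simp]:
  "quad (c0, c1, c2, c3) 0 = c0" "quad (c0, c1, c2, c3) (Suc 0) = c1"
  "quad (c0, c1, c2, c3) 2 = c2" "quad (c0, c1, c2, c3) 3 = c3"
  by (simp_all add: quad_def)

definition bits :: "(int \<times> int \<times> int \<times> int) set" where
  "bits = {0, 1} \<times> {0, 1} \<times> {0, 1} \<times> {0, 1}"

lemma sum_bits: "(\<Sum>c\<in>bits. f c) = (\<Sum>c0\<in>{0, 1}. \<Sum>c1\<in>{0, 1}. \<Sum>c2\<in>{0, 1}. \<Sum>c3\<in>{0, 1}. f (c0, c1, c2, c3))"
  unfolding bits_def by (simp only: sum.cartesian_product split_def fst_conv snd_conv prod.collapse)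

section \<open>The lattice\<close>

context
  fixes n1 n2 n3 n4 m1 m2 m3 m4 e :: nat
  assumes n: "n1 = 8 * m1 + 4 * e + 2" "n2 = 8 * m2 + 4 * e + 2"
    "n3 = 8 * m3 + 4 * e + 2" "n4 = 8 * m4 + 4 * e + 2"
begin

abbreviation (input) "dims \<equiv> n1 + n2 + n3 + n4"
abbreviation (input) "K \<equiv> blk n1 n2 n3 n4"
abbreviation (input) "B \<equiv> nbar n1 n2 n3 n4"
abbreviation (input) "lat \<equiv> Lat n1 n2 n3 n4"

section \<open>Splitting the coordinates into the four blocks\<close>

lemma K_simps [simp]: "K 0 = n1" "K (Suc 0) = n2" "K 2 = n3" "K 3 = n4"
  by (simp_all add: blk_def eval_nat_numeral)

lemma B_simps [simp]: "B 0 = 0" "B (Suc 0) = n1" "B 2 = n1 + n2" "B 3 = n1 + n2 + n3"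
  unfolding nbar_def by (simp_all add: eval_nat_numeral blk_def)

lemma K_eq:
  assumes "i < 4"
  obtains m where "K i = 8 * m + 4 * e + 2"
  using assms
proof (cases rule: less_4_cases)
  case 1 show ?thesis by (rule that[of m1]) (unfold 1 K_simps, rule n(1))
next
  case 2 show ?thesis by (rule that[of m2]) (unfold 2 One_nat_def K_simps, rule n(2))
next
  case 3 show ?thesis by (rule that[of m3]) (unfold 3 K_simps, rule n(3))
next
  case 4 show ?thesis by (rule that[of m4]) (unfold 4 K_simps, rule n(4))
qed

lemma even_K: "even (K i)" and K_pos: "K i > 0" if i: "i < 4"
proof -
  obtain m where "K i = 8 * m + 4 * e + 2"
    using i by (rule K_eq)
  then show "even (K i)" "K i > 0" by simp_all
qed

lemma block_coordinate:
  assumes "j < dims"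
  obtains i j' where "i < 4" "j' < K i" "j = B i + j'"
proof -
  consider "j < n1" | "n1 \<le> j" "j < n1 + n2" | "n1 + n2 \<le> j" "j < n1 + n2 + n3" | "n1 + n2 + n3 \<le> j"
    by linarith
  then show ?thesis
  proof cases
    case 1 show ?thesis by (rule that[of 0 j]) (use 1 in simp_all)
  next
    case 2 show ?thesis by (rule that[of 1 "j - n1"]) (use 2 in simp_all)
  next
    case 3 show ?thesis by (rule that[of 2 "j - (n1 + n2)"]) (use 3 in simp_all)
  next
    case 4 show ?thesis by (rule that[of 3 "j - (n1 + n2 + n3)"]) (use 4 assms in simp_all)
  qed
qed

lemma block_coordinate_less:
  assumes "i < 4" "j < K i"
  shows "B i + j < dims"
  using assms(1) by (cases rule: less_4_cases) (use assms(2) in simp_all)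

lemma block_coordinate_eq_iff:
  assumes "i < 4" "i' < 4" "j < K i" "j' < K i'"
  shows "B i + j = B i' + j' \<longleftrightarrow> i = i' \<and> j = j'"
  using assms(1)
proof (cases rule: less_4_cases)
  case 1 show ?thesis using assms(2) by (cases rule: less_4_cases) (use assms 1 in auto)
next
  case 2 show ?thesis using assms(2) by (cases rule: less_4_cases) (use assms 2 in auto)
next
  case 3 show ?thesis using assms(2) by (cases rule: less_4_cases) (use assms 3 in auto)
next
  case 4 show ?thesis using assms(2) by (cases rule: less_4_cases) (use assms 4 in auto)
qed

lemma sum_blocks: "(\<Sum>j<dims. f j) = (\<Sum>i<4. \<Sum>j<K i. f (B i + j))"
  for f :: "nat \<Rightarrow> 'a::comm_monoid_add"
  unfolding sum_lessThan_4 by (simp add: sum_lessThan_add add.assoc)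

lemma xv1_block:
  assumes "i < 4" "i' < 4" "j < K i"
  shows "xv1 n1 n2 n3 n4 i' (B i + j) = (if i = i' then 1 / 2 else 0)"
proof -
  have "B i' \<le> B i + j \<and> B i + j < B i' + K i' \<longleftrightarrow> (\<exists>j'<K i'. B i + j = B i' + j')"
    by (metis add_less_cancel_left le_add1 le_iff_add)
  then show ?thesis
    using block_coordinate_eq_iff[OF assms(1,2,3)] assms by (auto simp: xv1_def)
qed

lemma xv2_block:
  assumes "i < 4" "i' < 4" "j < K i"
  shows "xv2 n1 n2 n3 n4 i' (B i + j) = (if i = i' \<and> j = 0 then 1 else 0)"
  using block_coordinate_eq_iff[OF assms K_pos[OF assms(2)]] by (simp add: xv2_def)

section \<open>The lattice described by block types\<close>

definition glue :: "(nat \<Rightarrow> int) \<Rightarrow> nat \<Rightarrow> real" where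
  "glue c = (\<lambda>j. \<Sum>i<4. of_int (c i) * genv n1 n2 n3 n4 i j)"

lemma glue_block:
  assumes "i < 4" "j < K i"
  shows "glue c (B i + j) = glue_s c i / 2 + (if j = 0 then real_of_int (glue_p c i) else 0)"
proof -
  let ?g = "\<lambda>i'. (if i = i' then 1 / 2 else 0) + (if i = i' \<and> j = 0 then 1 else (0::real))"
  have "genv n1 n2 n3 n4 i' (B i + j) =
      (if i = i' \<and> j = 0 then 1 else 0) + ?g ((i' + 2) mod 4) + ?g ((i' + 3) mod 4)"
    if "i' < 4" for i'
    using that by (simp add: genv_def xv3_def xv1_block[OF assms(1) _ assms(2)]
        xv2_block[OF assms(1) _ assms(2)])
  then have "glue c (B i + j) = (\<Sum>i'<4. of_int (c i') *
      ((if i = i' \<and> j = 0 then 1 else 0) + ?g ((i' + 2) mod 4) + ?g ((i' + 3) mod 4)))"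
    unfolding glue_def by (intro sum.cong) auto
  also have "\<dots> = glue_s c i / 2 + (if j = 0 then real_of_int (glue_p c i) else 0)"
    using assms(1)
    by (cases rule: less_4_cases)
      (simp_all add: sum_lessThan_4 glue_s_simps glue_p_def add_divide_distrib flip: numeral_2_eq_2)
  finally show ?thesis .
qed

lemma xv_outside:
  assumes "i < 4" "j \<ge> dims"
  shows "xv1 n1 n2 n3 n4 i j = 0" "xv2 n1 n2 n3 n4 i j = 0"
proof -
  have "B i + (K i - 1) < dims"
    using assms(1) K_pos[OF assms(1)] by (intro block_coordinate_less) auto
  then have "\<not> j < B i + K i" "j \<noteq> B i"
    using K_pos[OF assms(1)] assms(2) by linarith+
  then show "xv1 n1 n2 n3 n4 i j = 0" "xv2 n1 n2 n3 n4 i j = 0"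
    by (simp_all add: xv1_def xv2_def)
qed

lemma glue_in_Rn: "glue c \<in> Rn dims"
  unfolding Rn_def glue_def genv_def xv3_def mem_Collect_eq
proof (intro allI impI sum.neutral ballI)
  fix j i assume "j \<ge> dims" "i \<in> {..<4::nat}"
  then show "of_int (c i) * (xv2 n1 n2 n3 n4 i j +
      (xv1 n1 n2 n3 n4 ((i + 2) mod 4) j + xv2 n1 n2 n3 n4 ((i + 2) mod 4) j) +
      (xv1 n1 n2 n3 n4 ((i + 3) mod 4) j + xv2 n1 n2 n3 n4 ((i + 3) mod 4) j)) = 0"
    by (simp add: xv_outside)
qed

lemma glue_block_type:
  assumes "i < 4"
  shows "block_type (B i) (K i) (glue_s c i) (glue_p c i) (glue c)"
  unfolding block_type_def
proof (intro conjI allI impI exI[of _ 0])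
  have "(\<Sum>j<K i. glue c (B i + j)) = (\<Sum>j<K i. glue_s c i / 2 + (if j = 0 then real_of_int (glue_p c i) else 0))"
    by (intro sum.cong) (use assms in \<open>auto simp: glue_block\<close>)
  then show "(\<Sum>j<K i. glue c (B i + j)) - real_of_int (glue_s c i) * real (K i) / 2
      = real_of_int (2 * 0 + glue_p c i)"
    using K_pos[OF assms] by (simp add: sum.distrib)
qed (use assms in \<open>auto simp: glue_block\<close>)

lemma Qset_eq: "Qset n1 n2 n3 n4 = {x \<in> Rn dims. \<forall>i<4. block_type (B i) (K i) 0 0 x}"
proof (intro set_eqI iffI)
  fix x assume x: "x \<in> {x \<in> Rn dims. \<forall>i<4. block_type (B i) (K i) 0 0 x}"
  have "x j \<in> \<int>" for j
  proof (cases "j < dims")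
    case True
    then show ?thesis
      by (rule block_coordinate) (use x in \<open>auto simp: block_type_def\<close>)
  qed (use x in \<open>auto simp: Rn_def\<close>)
  then show "x \<in> Qset n1 n2 n3 n4"
    using x by (auto simp: Qset_def block_type_def)
qed (auto simp: Qset_def block_type_def)

text \<open>A vector with the types of \<open>glue c\<close> differs from \<open>glue c\<close> by a
  vector of type (0, 0) on every block, that is, by an element of \<open>Qset\<close>.\<close>

lemma Lat_eq: "lat = {x \<in> Rn dims. \<exists>c. \<forall>i<4. block_type (B i) (K i) (glue_s c i) (glue_p c i) x}"
proof (intro set_eqI iffI)
  fix x assume "x \<in> lat"
  then obtain c y where y: "y \<in> Qset n1 n2 n3 n4" and x: "x = (\<lambda>j. glue c j + y j)"
    by (auto simp: Lat_def glue_def)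
  have "block_type (B i) (K i) (glue_s c i + 0) (glue_p c i + 0) x" if "i < 4" for i
    unfolding x using that y by (intro block_type_add glue_block_type) (auto simp: Qset_eq)
  moreover have "x \<in> Rn dims"
    using y glue_in_Rn by (auto simp: x Qset_def Rn_def)
  ultimately show "x \<in> {x \<in> Rn dims. \<exists>c. \<forall>i<4. block_type (B i) (K i) (glue_s c i) (glue_p c i) x}"
    by auto
next
  fix x assume "x \<in> {x \<in> Rn dims. \<exists>c. \<forall>i<4. block_type (B i) (K i) (glue_s c i) (glue_p c i) x}"
  then obtain c where x: "x \<in> Rn dims"
    and c: "\<And>i. i < 4 \<Longrightarrow> block_type (B i) (K i) (glue_s c i) (glue_p c i) x"
    by blast
  define y where "y = (\<lambda>j. x j + - glue c j)"
  have "block_type (B i) (K i) (glue_s c i + - glue_s c i) (glue_p c i + - glue_p c i) y"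
    if "i < 4" for i
    unfolding y_def using that by (intro block_type_add block_type_uminus glue_block_type c)
  moreover have "y \<in> Rn dims"
    using x glue_in_Rn by (auto simp: y_def Rn_def)
  ultimately have "y \<in> Qset n1 n2 n3 n4"
    by (auto simp: Qset_eq)
  moreover have "x = (\<lambda>j. glue c j + y j)"
    by (auto simp: y_def)
  ultimately show "x \<in> lat"
    unfolding Lat_def glue_def by blast
qed

lemma Qset_subset_Lat: "Qset n1 n2 n3 n4 \<subseteq> lat"
  by (auto simp: Lat_eq Qset_eq glue_s_def glue_p_def intro: exI[of _ "\<lambda>_. 0"])

lemma glue_in_Lat: "glue c \<in> lat"
  using glue_in_Rn glue_block_type by (auto simp: Lat_eq)

lemma Lat_add:
  assumes "x \<in> lat" "y \<in> lat"
  shows "(\<lambda>i. x i + y i) \<in> lat"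
proof -
  obtain c c' where c: "\<And>i. i < 4 \<Longrightarrow> block_type (B i) (K i) (glue_s c i) (glue_p c i) x"
    and c': "\<And>i. i < 4 \<Longrightarrow> block_type (B i) (K i) (glue_s c' i) (glue_p c' i) y"
    using assms by (auto simp: Lat_eq)
  have "block_type (B i) (K i) (glue_s (\<lambda>i. c i + c' i) i) (glue_p (\<lambda>i. c i + c' i) i) (\<lambda>i. x i + y i)"
    if "i < 4" for i
    using block_type_add[OF c[OF that] c'[OF that]] by (simp add: glue_s_def glue_p_def add_ac)
  then show ?thesis
    using assms unfolding Lat_eq by (auto simp: Rn_def)
qed

lemma Lat_uminus:
  assumes "x \<in> lat"
  shows "(\<lambda>i. - x i) \<in> lat"
proof -
  obtain c where c: "\<And>i. i < 4 \<Longrightarrow> block_type (B i) (K i) (glue_s c i) (glue_p c i) x"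
    using assms by (auto simp: Lat_eq)
  have "block_type (B i) (K i) (glue_s (\<lambda>i. - c i) i) (glue_p (\<lambda>i. - c i) i) (\<lambda>i. - x i)"
    if "i < 4" for i
    using block_type_uminus[OF c[OF that]] by (simp add: glue_s_def glue_p_def add_ac)
  then show ?thesis
    using assms unfolding Lat_eq by (auto simp: Rn_def)
qed

section \<open>Evenness and minimal norm\<close>

lemma even_Lat: "even_lattice dims lat"
  unfolding even_lattice_def
proof
  fix x assume "x \<in> lat"
  then obtain c where c: "\<And>i. i < 4 \<Longrightarrow> block_type (B i) (K i) (glue_s c i) (glue_p c i) x"
    by (auto simp: Lat_eq)
  \<comment> \<open>Since K i = 8m + 4e + 2, the term s^2 K i / 4 of the block norm is s^2 (e + 1/2)
    up to the even integer 2 m s^2. The number e is common to all blocks.\<close>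
  have "\<forall>i\<in>{..<4}. \<exists>d::int. (\<Sum>j<K i. x (B i + j) * x (B i + j))
      = real_of_int (2 * d + (1 + glue_s c i) * glue_p c i) + real_of_int ((glue_s c i)\<^sup>2) * (e + 1 / 2)"
  proof
    fix i :: nat assume "i \<in> {..<4}"
    then have i: "i < 4" by simp
    obtain m where m: "K i = 8 * m + 4 * e + 2"
      using i by (rule K_eq)
    obtain d :: int where "(\<Sum>j<K i. x (B i + j) * x (B i + j))
      = 2 * real_of_int d + real_of_int ((1 + glue_s c i) * glue_p c i) + real_of_int ((glue_s c i)\<^sup>2) * real (K i) / 4"
      using c[OF i] by (rule block_type_norm)
    then have "(\<Sum>j<K i. x (B i + j) * x (B i + j))
      = real_of_int (2 * (d + (glue_s c i)\<^sup>2 * int m) + (1 + glue_s c i) * glue_p c i)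
        + real_of_int ((glue_s c i)\<^sup>2) * (e + 1 / 2)"
      by (simp add: m field_simps)
    then show "\<exists>d::int. (\<Sum>j<K i. x (B i + j) * x (B i + j))
      = real_of_int (2 * d + (1 + glue_s c i) * glue_p c i) + real_of_int ((glue_s c i)\<^sup>2) * (e + 1 / 2)"
      by (rule exI)
  qed
  from bchoice[OF this] obtain d where d: "\<forall>i\<in>{..<4}. (\<Sum>j<K i. x (B i + j) * x (B i + j))
      = real_of_int (2 * d i + (1 + glue_s c i) * glue_p c i) + real_of_int ((glue_s c i)\<^sup>2) * (e + 1 / 2)" ..
  \<comment> \<open>The last two contributions are half the sum of the
    \<open>(glue_s c i)^2\<close>: expanding these squares of cyclic sums gives twice the sum of the
    \<open>(c i)^2\<close> plus twice \<open>(c 0 + c 2) * (c 1 + c 3)\<close>.\<close>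
  define W where "W = (\<Sum>i<4. (1 + glue_s c i) * glue_p c i + (glue_s c i)\<^sup>2 * int e + (c i)\<^sup>2)
     + (c 0 + c 2) * (c 1 + c 3)"
  have "even W"
    by (cases "even (c 0)"; cases "even (c 1)"; cases "even (c 2)"; cases "even (c 3)")
      (simp_all add: W_def sum_lessThan_4 glue_s_simps glue_p_def flip: numeral_2_eq_2)
  then obtain w where w: "W = 2 * w" ..
  have "ip dims x x = (\<Sum>i<4. real_of_int (2 * d i + (1 + glue_s c i) * glue_p c i)
      + real_of_int ((glue_s c i)\<^sup>2) * (e + 1 / 2))"
    unfolding ip_def sum_blocks by (intro sum.cong refl d[rule_format])
  also have "\<dots> = 2 * real_of_int (\<Sum>i<4. d i) + real_of_int W"
    by (simp add: W_def sum_lessThan_4 glue_s_simps power2_eq_square field_simps)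
  finally have "ip dims x x = 2 * real_of_int ((\<Sum>i<4. d i) + w)"
    by (simp add: w)
  then show "\<exists>k::int. ip dims x x = 2 * k" ..
qed

lemma ip_self_nonneg: "ip N x x \<ge> 0"
  unfolding ip_def by (intro sum_nonneg) auto

lemma Lat_norm_ge_2:
  assumes "x \<in> lat" "x \<noteq> (\<lambda>_. 0)"
  shows "ip dims x x \<ge> 2"
proof -
  obtain k :: int where k: "ip dims x x = 2 * k"
    using even_Lat assms by (auto simp: even_lattice_def)
  have "ip dims x x \<noteq> 0"
  proof
    assume "ip dims x x = 0"
    then have "\<forall>j<dims. x j = 0"
      unfolding ip_def by (subst (asm) sum_nonneg_eq_0_iff) auto
    then have "x j = 0" for j
      using assms(1) by (cases "j < dims") (auto simp: Lat_eq Rn_def)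
    then show False using assms(2) by auto
  qed
  then show ?thesis
    using ip_self_nonneg[of dims x] unfolding k by simp
qed

text \<open>These vectors span the space, and pairing with them makes the coordinates of a dual
  vector half-integers.\<close>

lemma double_unit_in_Qset:
  assumes "j < dims"
  shows "(\<lambda>i. if i = j then 2 else 0) \<in> Qset n1 n2 n3 n4"
proof -
  have "\<exists>k::int. (\<Sum>l<K i. if B i + l = j then 2 else 0) = 2 * real_of_int k" for i
    by (intro exI[of _ "\<Sum>l<K i. if B i + l = j then 1 else 0"])
      (auto simp: sum_distrib_left intro!: sum.cong)
  then show ?thesis
    using assms by (auto simp: Qset_def Rn_def)
qed

text \<open>Pairing with these vectors makes the coordinates of a dual vector congruent modulo 1
  within each block.\<close>

lemma unit_difference_in_Qset:
  assumes i: "i < 4" "j < K i" "j' < K i"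
  shows "(\<lambda>l. (if l = B i + j then 1 else 0) - (if l = B i + j' then 1 else 0)) \<in> Qset n1 n2 n3 n4"
    (is "?x \<in> _")
proof -
  have *: "(\<Sum>l<K i'. if B i' + l = B i + a then 1 else 0) = (if i' = i then 1 else (0::real))"
    if "i' < 4" "a < K i" for i' a
  proof -
    have "(\<Sum>l<K i'. if B i' + l = B i + a then 1 else 0)
        = (\<Sum>l<K i'. if l = a then (if i' = i then 1 else 0) else (0::real))"
      using that i by (intro sum.cong) (auto simp: block_coordinate_eq_iff)
    then show ?thesis using that by auto
  qed
  have "(\<Sum>l<K i'. ?x (B i' + l)) = 0" if "i' < 4" for i'
    by (simp add: sum_subtractf *[OF that] i del: add_left_imp_eq)
  then show ?thesis
    using block_coordinate_less[OF i(1,2)] block_coordinate_less[OF i(1,3)]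
    by (auto simp: Qset_def Rn_def intro!: exI[of _ 0])
qed

lemma is_lattice_Lat: "is_lattice dims lat"
  unfolding is_lattice_def
proof (intro conjI ballI)
  show "lat \<subseteq> Rn dims" by (auto simp: Lat_eq)
  show "(\<lambda>_. 0) \<in> lat"
    using glue_in_Lat[of "\<lambda>_. 0"] by (simp add: glue_def)
  show "\<exists>e>0. \<forall>x\<in>lat. x \<noteq> (\<lambda>_. 0) \<longrightarrow> e \<le> ip dims x x"
    using Lat_norm_ge_2 by (intro exI[of _ 2]) auto
  show "\<exists>b::nat \<Rightarrow> nat \<Rightarrow> real. (\<forall>i<dims. b i \<in> lat) \<and>
        (\<forall>x\<in>Rn dims. \<exists>c::nat \<Rightarrow> real. x = (\<lambda>j. \<Sum>i<dims. c i * b i j))"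
  \<comment> \<open>The family only has to span \<open>Rn dims\<close> over the reals, so twice the
    unit vectors suffice, with coefficients \<open>x i / 2\<close>.\<close>
  proof (intro exI[of _ "\<lambda>j i. if i = j then 2 else 0"] conjI ballI allI impI)
    fix x assume "x \<in> Rn dims"
    then show "\<exists>c::nat \<Rightarrow> real. x = (\<lambda>j. \<Sum>i<dims. c i * (if j = i then 2 else 0))"
      by (intro exI[of _ "\<lambda>i. x i / 2"]) (auto simp: Rn_def if_distrib cong: if_cong)
  qed (use double_unit_in_Qset Qset_subset_Lat in blast)
qed (use Lat_add Lat_uminus in auto)

lemma pos_def_Lat: "pos_def_lattice dims lat"
  using is_lattice_Lat Lat_norm_ge_2 by (force simp: pos_def_lattice_def)

section \<open>Integrality and self-duality\<close>

lemma ip_glue: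
  "ip dims x (glue c) = (\<Sum>i<4. glue_s c i / 2 * (\<Sum>j<K i. x (B i + j)) + glue_p c i * x (B i))"
  for x :: "nat \<Rightarrow> real"
  unfolding ip_def sum_blocks
proof (intro sum.cong refl)
  fix i :: nat assume "i \<in> {..<4}"
  then have i: "i < 4" by simp
  have "(\<Sum>j<K i. x (B i + j) * glue c (B i + j))
      = (\<Sum>j<K i. glue_s c i / 2 * x (B i + j) + (if j = 0 then real_of_int (glue_p c i) * x (B i) else 0))"
  proof (intro sum.cong refl)
    fix j assume "j \<in> {..<K i}"
    then have "j < K i" by simp
    from glue_block[OF i this]
    show "x (B i + j) * glue c (B i + j)
        = glue_s c i / 2 * x (B i + j) + (if j = 0 then real_of_int (glue_p c i) * x (B i) else 0)"
      by (simp add: distrib_left mult.commute)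
  qed
  then show "(\<Sum>j<K i. x (B i + j) * glue c (B i + j))
      = glue_s c i / 2 * (\<Sum>j<K i. x (B i + j)) + glue_p c i * x (B i)"
    using K_pos[OF i] by (simp add: sum.distrib sum_distrib_left)
qed

text \<open>The sum is twice the inner product, reduced modulo 2. The terms
  \<open>glue_s c i * s i\<close> cancel modulo 2: one comes from the coordinate sum, with the odd
  factor K i / 2, the other from the summand \<open>glue_s c i\<close> of
  \<open>glue_p c i\<close>.\<close>

lemma ip_glue_integral:
  assumes x: "\<And>i. i < 4 \<Longrightarrow> block_type (B i) (K i) (s i) (p i) x"
    and int: "ip dims x (glue c) \<in> \<int>"
  shows "even (\<Sum>i<4. glue_s c i * p i + c i * s i)"
proof -
  have "\<forall>i\<in>{..<4}. \<exists>d. 2 * (glue_s c i / 2 * (\<Sum>j<K i. x (B i + j)) + glue_p c i * x (B i))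
      = real_of_int (2 * d + (glue_s c i * p i + c i * s i))"
  proof
    fix i :: nat assume "i \<in> {..<4}"
    then have i: "i < 4" by simp
    obtain t d where t: "\<And>j. j < K i \<Longrightarrow> x (B i + j) = t j + s i / 2"
      and d: "(\<Sum>j<K i. t j) = 2 * d + p i"
      using x[OF i] by (rule block_typeE) blast
    obtain m where m: "K i = 8 * m + 4 * e + 2"
      using i by (rule K_eq)
    have "(\<Sum>j<K i. x (B i + j)) = (\<Sum>j<K i. real_of_int (t j) + s i / 2)"
      by (intro sum.cong) (auto simp: t)
    also have "\<dots> = real_of_int (\<Sum>j<K i. t j) + s i * K i / 2"
      by (simp add: sum.distrib)
    also have "real_of_int (s i * K i) / 2 = s i * (4 * m + 2 * e + 1)"
      by (simp add: m algebra_simps)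
    finally have S: "(\<Sum>j<K i. x (B i + j)) = 2 * d + p i + s i * (4 * m + 2 * e + 1)"
      unfolding d by simp
    have x0: "x (B i) = t 0 + s i / 2"
      using t[OF K_pos[OF i]] by simp
    have "2 * (glue_s c i / 2 * (\<Sum>j<K i. x (B i + j)) + glue_p c i * x (B i))
      = real_of_int (2 * (glue_s c i * d + glue_s c i * s i * (2 * int m + int e + 1) + glue_p c i * t 0)
        + (glue_s c i * p i + c i * s i))"
      unfolding S x0 glue_p_def by (simp add: field_simps)
    then show "\<exists>d. 2 * (glue_s c i / 2 * (\<Sum>j<K i. x (B i + j)) + glue_p c i * x (B i))
      = real_of_int (2 * d + (glue_s c i * p i + c i * s i))"
      by (rule exI)
  qed
  from bchoice[OF this] obtain d where
    d: "\<forall>i\<in>{..<4}. 2 * (glue_s c i / 2 * (\<Sum>j<K i. x (B i + j)) + glue_p c i * x (B i))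
      = real_of_int (2 * d i + (glue_s c i * p i + c i * s i))" ..
  obtain k :: int where k: "ip dims x (glue c) = k"
    using int by (auto elim: Ints_cases)
  have "2 * real_of_int k = 2 * ip dims x (glue c)" by (simp add: k)
  also have "\<dots> = (\<Sum>i<4. real_of_int (2 * d i + (glue_s c i * p i + c i * s i)))"
    unfolding ip_glue sum_distrib_left[of 2 _ "{..<4}"] by (intro sum.cong refl d[rule_format])
  finally have "real_of_int (2 * k) = real_of_int (\<Sum>i<4. 2 * d i + (glue_s c i * p i + c i * s i))"
    by simp
  then have "2 * k = (\<Sum>i<4. 2 * d i + (glue_s c i * p i + c i * s i))"
    by (simp only: of_int_eq_iff)
  then have "(\<Sum>i<4. glue_s c i * p i + c i * s i) = 2 * (k - (\<Sum>i<4. d i))"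
    by (simp add: sum.distrib sum_distrib_left)
  then show ?thesis by simp
qed

lemma unimodular_Lat: "unimodular dims lat"
  unfolding unimodular_def
proof (intro set_eqI iffI)
  fix x assume x: "x \<in> lat"
  have "ip dims x y \<in> \<int>" if y: "y \<in> lat" for y
  proof -
    have even: "\<exists>k::int. ip dims u u = 2 * of_int k" if "u \<in> lat" for u
      using even_Lat that unfolding even_lattice_def by (rule bspec)
    obtain k where "ip dims x x = 2 * of_int k" using even[OF x] ..
    moreover obtain l where "ip dims y y = 2 * of_int l" using even[OF y] ..
    moreover obtain r where "ip dims (\<lambda>i. x i + y i) (\<lambda>i. x i + y i) = 2 * of_int r"
      using even[OF Lat_add[OF x y]] ..
    \<comment> \<open>Polarization: three even norms make twice the inner product even.\<close>
    moreover have "ip dims (\<lambda>i. x i + y i) (\<lambda>i. x i + y i) = ip dims x x + 2 * ip dims x y + ip dims y y"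
      by (simp add: ip_def algebra_simps sum.distrib sum_distrib_left)
    ultimately have "ip dims x y = of_int (r - k - l)" by simp
    then show ?thesis by simp
  qed
  then show "x \<in> {x \<in> Rn dims. \<forall>y\<in>lat. ip dims x y \<in> \<int>}"
    using x by (auto simp: Lat_eq)
next
  fix x assume "x \<in> {x \<in> Rn dims. \<forall>y\<in>lat. ip dims x y \<in> \<int>}"
  then have x: "x \<in> Rn dims" and int: "\<And>y. y \<in> lat \<Longrightarrow> ip dims x y \<in> \<int>" by auto
  have "\<forall>i\<in>{..<4}. \<exists>sp. block_type (B i) (K i) (fst sp) (snd sp) x"
  proof
    fix i :: nat assume "i \<in> {..<4}"
    then have i: "i < 4" by simp
    have "ip dims x (\<lambda>l. if l = B i then 2 else 0) \<in> \<int>"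
      using double_unit_in_Qset block_coordinate_less[OF i K_pos[OF i]] Qset_subset_Lat
      by (intro int) auto
    also have "ip dims x (\<lambda>l. if l = B i then 2 else 0) = x (B i) * 2"
      using block_coordinate_less[OF i K_pos[OF i]] by (simp add: ip_def if_distrib cong: if_cong)
    finally obtain s :: int where s: "x (B i) * 2 = s" by (auto elim: Ints_cases)
    have t: "x (B i + j) - s / 2 \<in> \<int>" if j: "j < K i" for j
    proof -
      have "ip dims x (\<lambda>l. (if l = B i + j then 1 else 0) - (if l = B i + 0 then 1 else 0)) \<in> \<int>"
        using unit_difference_in_Qset[OF i j K_pos[OF i]] Qset_subset_Lat by (intro int) auto
      also have "ip dims x (\<lambda>l. (if l = B i + j then 1 else 0) - (if l = B i + 0 then 1 else 0))
          = x (B i + j) - x (B i)"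
        using block_coordinate_less[OF i K_pos[OF i]] block_coordinate_less[OF i j]
        unfolding ip_def right_diff_distrib sum_subtractf
        by (simp add: if_distrib[where f = "\<lambda>y. _ * y"] cong: if_cong)
      also have "x (B i) = s / 2" using s by simp
      finally show ?thesis .
    qed
    have "(\<Sum>j<K i. x (B i + j)) - s * K i / 2 = (\<Sum>j<K i. x (B i + j) - s / 2)"
      by (simp add: sum_subtractf)
    also have "\<dots> \<in> \<int>" using t by (intro Ints_sum) auto
    finally obtain p :: int where "(\<Sum>j<K i. x (B i + j)) - s * K i / 2 = p"
      by (auto elim: Ints_cases)
    then have "block_type (B i) (K i) (fst (s, p)) (snd (s, p)) x"
      using t by (auto simp: block_type_def intro!: exI[of _ 0])
    then show "\<exists>sp. block_type (B i) (K i) (fst sp) (snd sp) x"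
      by (rule exI)
  qed
  from bchoice[OF this] obtain h
    where h: "\<forall>i\<in>{..<4}. block_type (B i) (K i) (fst (h i)) (snd (h i)) x" ..
  define s p where "s i = fst (h i)" and "p i = snd (h i)" for i
  have sp: "block_type (B i) (K i) (s i) (p i) x" if "i < 4" for i
    using h that by (simp add: s_def p_def)
  have par: "even (\<Sum>i<4. glue_s c i * p i + c i * s i)" for c
    by (rule ip_glue_integral[OF sp int[OF glue_in_Lat]])
  \<comment> \<open>Testing against the i-th generator alone gives the parity check s i + p (i+2) +
    p (i+3), indices modulo 4.\<close>
  have par0: "even (s 0 + p 2 + p 3)"
    using par[of "\<lambda>i. if i = 0 then 1 else 0"] by (auto simp: glue_s_simps sum_lessThan_4)
  have par1: "even (s 1 + p 3 + p 0)"
    using par[of "\<lambda>i. if i = 1 then 1 else 0"] by (auto simp: glue_s_simps sum_lessThan_4)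
  have par2: "even (s 2 + p 0 + p 1)"
    using par[of "\<lambda>i. if i = 2 then 1 else 0"] by (auto simp: glue_s_simps sum_lessThan_4)
  have par3: "even (s 3 + p 1 + p 2)"
    using par[of "\<lambda>i. if i = 3 then 1 else 0"] by (auto simp: glue_s_simps sum_lessThan_4)
  \<comment> \<open>Forced modulo 2, because \<open>glue_p c i = c i + glue_s c i\<close>. The four
    parity checks say that this choice also reproduces s.\<close>
  define c where "c i = p i + s i" for i
  have "even (s i - glue_s c i) \<and> even (p i - glue_p c i)" if "i < 4" for i
    using that par0 par1 par2 par3
    by (cases rule: less_4_cases; cases "even (p 0)"; cases "even (p 1)"; cases "even (p 2)"; cases "even (p 3)")
      (simp_all add: glue_p_def glue_s_simps c_def flip: numeral_2_eq_2)
  then have "block_type (B i) (K i) (glue_s c i) (glue_p c i) x" if "i < 4" for i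
    using that by (intro block_type_mod_2[OF sp[OF that] even_K[OF that]]) auto
  with x show "x \<in> lat" by (auto simp: Lat_eq)
qed

section \<open>The theta series of the lattice as a sum over 16 cosets\<close>

definition coset :: "int \<times> int \<times> int \<times> int \<Rightarrow> (nat \<Rightarrow> real) set" where
  "coset c = {x \<in> Rn dims. \<forall>i<4. block_type (B i) (K i) (glue_s (quad c) i) (glue_p (quad c) i) x}"

lemma coset_theta:
  assumes z: "Im z > 0"
  shows "((\<lambda>x. qpow z (ip dims x x)) has_sum
    (\<Prod>i<4. block_theta z (K i) (glue_s (quad c) i) (glue_p (quad c) i))) (coset c)"
proof -
  have all4: "(\<forall>i<4. P i) \<longleftrightarrow> P 0 \<and> P (Suc 0) \<and> P 2 \<and> P 3" for P :: "nat \<Rightarrow> bool"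
    by (auto elim: less_4_cases)
  have b: "((\<lambda>x. qpow z (ip (K i) x x)) has_sum block_theta z (K i) s p)
      {x \<in> Rn (K i). block_type 0 (K i) s p x}" if "i < 4" for i s p
    using that by (intro block_theta_has_sum z even_K K_pos)
  let ?s = "glue_s (quad c)" and ?p = "glue_p (quad c)"
  \<comment> \<open>The set is put into the right-nested form that repeated use of
    \<open>theta_append\<close> produces.\<close>
  have "coset c = {x \<in> Rn (K 0 + (K 1 + (K 2 + K 3))).
      block_type 0 (K 0) (?s 0) (?p 0) (take_coords (K 0) x) \<and>
      block_type 0 (K 1) (?s 1) (?p 1) (take_coords (K 1) (\<lambda>j. x (K 0 + j))) \<and>
      block_type 0 (K 2) (?s 2) (?p 2) (take_coords (K 2) (\<lambda>j. x (K 0 + (K 1 + j)))) \<and>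
      block_type 0 (K 3) (?s 3) (?p 3) (\<lambda>j. x (K 0 + (K 1 + (K 2 + j))))}"
    unfolding coset_def all4 block_type_take_coords
    by (simp add: block_type_def add.assoc)
  then show ?thesis
    using theta_append[OF b[of 0] theta_append[OF b[of 1] theta_append[OF b[of 2] b[of 3]]],
        of "?s 0" "?p 0" "?s 1" "?p 1" "?s 2" "?p 2" "?s 3" "?p 3"]
    by (simp add: prod_lessThan_4 add.assoc mult.assoc)
qed

lemma Lat_eq_Union_coset: "lat = (\<Union>c\<in>bits. coset c)"
proof (intro set_eqI iffI)
  fix x assume x: "x \<in> lat"
  then obtain c where c: "\<And>i. i < 4 \<Longrightarrow> block_type (B i) (K i) (glue_s c i) (glue_p c i) x"
    by (auto simp: Lat_eq)
  define d where "d = (c 0 mod 2, c 1 mod 2, c 2 mod 2, c 3 mod 2)"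
  have "block_type (B i) (K i) (glue_s (quad d) i) (glue_p (quad d) i) x" if i: "i < 4" for i
  proof (rule block_type_mod_2[OF c[OF i] even_K[OF i]])
    show "even (glue_s c i - glue_s (quad d) i)"
      using i by (cases rule: less_4_cases) (auto simp: glue_s_simps d_def)
    with i show "even (glue_p c i - glue_p (quad d) i)"
      by (cases rule: less_4_cases) (auto simp: glue_p_def d_def)
  qed
  moreover have "x \<in> Rn dims"
    using x by (simp add: Lat_eq)
  ultimately have "x \<in> coset d"
    unfolding coset_def by blast
  moreover have "k mod 2 \<in> {0, 1}" for k :: int
    by simp presburger
  then have "d \<in> bits"
    unfolding d_def bits_def by (intro SigmaI)
  ultimately show "x \<in> (\<Union>c\<in>bits. coset c)" by blast
next
  fix x assume "x \<in> (\<Union>c\<in>bits. coset c)"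
  then obtain c where "x \<in> coset c" ..
  then show "x \<in> lat"
    unfolding coset_def Lat_eq by blast
qed

text \<open>The types determine c modulo 2, since \<open>glue_p c i - glue_s c i = c i\<close>, and
  the entries of elements of \<open>bits\<close> are determined by their parity.\<close>

lemma coset_disjoint:
  assumes c: "c \<in> bits" and d: "d \<in> bits" and "c \<noteq> d"
  shows "coset c \<inter> coset d = {}"
proof (rule equals0I)
  fix x assume x: "x \<in> coset c \<inter> coset d"
  have "even (quad c i - quad d i)" if i: "i < 4" for i
  proof -
    have "block_type (B i) (K i) (glue_s (quad c) i) (glue_p (quad c) i) x"
      "block_type (B i) (K i) (glue_s (quad d) i) (glue_p (quad d) i) x"
      using x i by (auto simp: coset_def)
    note block_type_unique[OF this even_K[OF i] K_pos[OF i]]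
    then show ?thesis by (auto simp: glue_p_def)
  qed
  note even = this[of 0] this[of 1] this[of 2] this[of 3]
  obtain c0 c1 c2 c3 where c': "c = (c0, c1, c2, c3)" by (cases c)
  obtain d0 d1 d2 d3 where d': "d = (d0, d1, d2, d3)" by (cases d)
  have eq: "a = b" if "a \<in> {0, 1}" "b \<in> {0, 1}" "even (a - b)" for a b :: int
    using that by auto
  have "c0 = d0" "c1 = d1" "c2 = d2" "c3 = d3"
    using c d even unfolding bits_def c' d' mem_Times_iff fst_conv snd_conv
    by (auto intro!: eq simp del: even_diff)
  then have "c = d" by (simp add: c' d')
  with \<open>c \<noteq> d\<close> show False by contradiction
qed

lemma Lat_theta:
  assumes z: "Im z > 0"
  shows "((\<lambda>x. qpow z (ip dims x x)) has_sum
    (\<Sum>c\<in>bits. \<Prod>i<4. block_theta z (K i) (glue_s (quad c) i) (glue_p (quad c) i))) lat"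
  unfolding Lat_eq_Union_coset
proof (rule has_sum_UN_disjoint)
  show "finite bits" by (simp add: bits_def)
qed (use coset_theta[OF z] coset_disjoint in blast)+

text \<open>A polynomial identity in the twelve powers. Two of the words have no half-integral
  block, twelve have two, and two have four.\<close>

lemma sum_block_thetas:
  fixes z
  defines "x \<equiv> theta2 z" and "y \<equiv> theta3 z" and "w \<equiv> theta4 z"
  shows "(\<Sum>c\<in>bits. \<Prod>i<4. block_theta z (K i) (glue_s (quad c) i) (glue_p (quad c) i)) =
    (x ^ n1 * x ^ n2 * x ^ n3 * x ^ n4 + y ^ n1 * y ^ n2 * y ^ n3 * y ^ n4 + w ^ n1 * w ^ n2 * w ^ n3 * w ^ n4) / 2
    - ((y ^ n1 * y ^ n2 - x ^ n1 * x ^ n2 - w ^ n1 * w ^ n2) * (y ^ n3 * y ^ n4 - x ^ n3 * x ^ n4 - w ^ n3 * w ^ n4)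
     + (y ^ n1 * y ^ n3 - x ^ n1 * x ^ n3 - w ^ n1 * w ^ n3) * (y ^ n2 * y ^ n4 - x ^ n2 * x ^ n4 - w ^ n2 * w ^ n4)
     + (y ^ n1 * y ^ n4 - x ^ n1 * x ^ n4 - w ^ n1 * w ^ n4) * (y ^ n2 * y ^ n3 - x ^ n2 * x ^ n3 - w ^ n2 * w ^ n3)) / 8"
  unfolding sum_bits prod_lessThan_4 block_theta_def glue_p_def
  by (simp add: glue_s_simps sg_def flip: x_def y_def w_def) (simp add: field_simps)

end

section \<open>The theta series in terms of \<open>hfun\<close>, \<open>Delta24\<close> and
  \<open>rho\<close>\<close>

text \<open>The convention \<open>\<rho>\<^sub>-\<^sub>1 = 0\<close> agrees with the general formula because of Jacobi's identity.\<close>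

lemma rho_times_power:
  assumes z: "Im z > 0"
  shows "rho (int k - 1) z * (theta2 z * theta3 z * theta4 z) ^ 4
    = theta3 z ^ (8 * k + 4) - theta2 z ^ (8 * k + 4) - theta4 z ^ (8 * k + 4)"
proof (cases k)
  case 0
  then show ?thesis
    using Jacobi_quartic_identity[OF z] by (simp add: rho_def)
next
  case (Suc l)
  then show ?thesis
    using theta_nonzero[OF z] by (simp add: rho_def Let_def)
qed

theorem theorem3p3:
  fixes m1 m2 m3 m4 \<epsilon> :: nat
  assumes "\<epsilon> \<in> {0, 1}"
  defines "n1 \<equiv> 8*m1 + 4*\<epsilon> + 2" and "n2 \<equiv> 8*m2 + 4*\<epsilon> + 2"
      and "n3 \<equiv> 8*m3 + 4*\<epsilon> + 2" and "n4 \<equiv> 8*m4 + 4*\<epsilon> + 2"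
  defines "n \<equiv> n1 + n2 + n3 + n4" and "L \<equiv> Lat n1 n2 n3 n4"
  shows "pos_def_lattice n L \<and> even_lattice n L \<and> unimodular n L \<and>
    (\<forall>z. Im z > 0 \<longrightarrow> theta_series_has n L z
      (hfun (m1+m2+m3+m4+2*\<epsilon>+1) z / 2
       - 32 * Delta24 z *
         (rho (int (m1+m2+\<epsilon>) - 1) z * rho (int (m3+m4+\<epsilon>) - 1) z
        + rho (int (m1+m3+\<epsilon>) - 1) z * rho (int (m2+m4+\<epsilon>) - 1) z
        + rho (int (m1+m4+\<epsilon>) - 1) z * rho (int (m2+m3+\<epsilon>) - 1) z)))"
proof (intro conjI allI impI)
  note n = n1_def[THEN meta_eq_to_obj_eq] n2_def[THEN meta_eq_to_obj_eq]
    n3_def[THEN meta_eq_to_obj_eq] n4_def[THEN meta_eq_to_obj_eq]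
  show "pos_def_lattice n L" "even_lattice n L" "unimodular n L"
    unfolding n_def L_def
    by (rule pos_def_Lat[OF n] even_Lat[OF n] unimodular_Lat[OF n])+
  fix z :: complex assume z: "Im z > 0"
  let ?x = "theta2 z" and ?y = "theta3 z" and ?w = "theta4 z"
  define D where "D = (?x * ?y * ?w) ^ 4"
  \<comment> \<open>\<open>Delta24 z\<close> is D^2 / 2^8. In each product of two \<open>rho\<close>
    values, either factor absorbs one D, and 32 / 2^8 is the 1/8 of
    \<open>sum_block_thetas\<close>.\<close>
  have Delta: "32 * Delta24 z = D * D / 8"
    by (simp add: Delta24_def D_def power_divide flip: power_add)
  \<comment> \<open>Two block lengths add up to 8 (m_i + m_j + \<epsilon>) + 4, the exponent in
    \<open>rho\<close> at index m_i + m_j + \<epsilon> - 1; all four add up to the exponent in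
    \<open>hfun\<close>.\<close>
  have split: "t ^ (8 * (m1+m2+\<epsilon>) + 4) = t ^ n1 * t ^ n2" "t ^ (8 * (m3+m4+\<epsilon>) + 4) = t ^ n3 * t ^ n4"
    "t ^ (8 * (m1+m3+\<epsilon>) + 4) = t ^ n1 * t ^ n3" "t ^ (8 * (m2+m4+\<epsilon>) + 4) = t ^ n2 * t ^ n4"
    "t ^ (8 * (m1+m4+\<epsilon>) + 4) = t ^ n1 * t ^ n4" "t ^ (8 * (m2+m3+\<epsilon>) + 4) = t ^ n2 * t ^ n3"
    "t ^ (8 * (m1+m2+m3+m4+2*\<epsilon>+1)) = t ^ n1 * t ^ n2 * t ^ n3 * t ^ n4" for t :: complex
    unfolding n1_def n2_def n3_def n4_def power_add[symmetric]
    by (rule arg_cong[where f = "\<lambda>k. t ^ k"], simp)+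
  note rho = rho_times_power[OF z, folded D_def, unfolded split]
  have "D * D / 8 * (r1 * r2 + r3 * r4 + r5 * r6)
      = ((r1 * D) * (r2 * D) + (r3 * D) * (r4 * D) + (r5 * D) * (r6 * D)) / 8" for r1 r2 r3 r4 r5 r6
    by (simp add: field_simps)
  note expand = this
  show "theta_series_has n L z
      (hfun (m1+m2+m3+m4+2*\<epsilon>+1) z / 2
       - 32 * Delta24 z *
         (rho (int (m1+m2+\<epsilon>) - 1) z * rho (int (m3+m4+\<epsilon>) - 1) z
        + rho (int (m1+m3+\<epsilon>) - 1) z * rho (int (m2+m4+\<epsilon>) - 1) z
        + rho (int (m1+m4+\<epsilon>) - 1) z * rho (int (m2+m3+\<epsilon>) - 1) z))"
    using Lat_theta[OF n z]
    unfolding theta_series_has_def n_def L_def sum_block_thetas[OF n] Delta expand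
      rho_times_power[OF z, folded D_def] hfun_def split .
qed

end
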